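(* If $P\colon\mathcal C^{op}\to\mathbf{InfSL}$ is an elementary doctrine, then its existential completion $P^e\colon\mathcal C^{op}\to\mathbf{InfSL}$ is an elementary existential doctrine (i.e. it is both elementary and existential).
   Context: An inf-semilattice is a poset with finite meets (including a top element $\top$); $\mathbf{InfSL}$ is the category of inf-semilattices and finite-meet-preserving maps. No size distinctions are made between categories and fibres. A primary doctrine is a functor $P\colon \mathcal C^{op}\to\mathbf{InfSL}$ with $\mathcal C$ a category with finite products; for $f\colon A\to B$ write $P_f\colon P(B)\to P(A)$ for its action. A morphism $X\to A$ is called a projection if it is one of the legs of a binary product diagram $A\leftarrow X\to B$ for some object $B$. A primary doctrine $P$ is elementary if for every object $A$ there is $\delta_A\in P(A\times A)$ such that (1) $\alpha\mapsto P_{\mathrm{pr}_1}(\alpha)\wedge\delta_A$ is left adjoint to $P_{\langle\mathrm{id}_A,\mathrm{id}_A\rangle}\colon P(A\times A)\to P(A)$; and (2) for every morphism $e=\langle\mathrm{pr}_1,\mathrm{pr}_2,\mathrm{pr}_2\rangle\colon X\times A\to X\times A\times A$, the assignment $\alpha\mapsto P_{\langle\mathrm{pr}_1,\mathrm{pr}_2\rangle}(\alpha)\wedge P_{\langle\mathrm{pr}_2,\mathrm{pr}_3\rangle}(\delta_A)$ is left adjoint to $P_e\colon P(X\times A\times A)\to P(X\times A)$. A primary doctrine $P$ is existential if for every projection $\mathrm{pr}\colon X\to A$ the map $P_{\mathrm{pr}}$ has a left adjoint $\exists_{\mathrm{pr}}$ and these satisfy: (Beck-Chevalley) for any pullback square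 $f\,\mathrm{pr}'=\mathrm{pr} f'$ with $\mathrm{pr}\colon X\to A$, $\mathrm{pr}'\colon X'\to A'$ projections, $\exists_{\mathrm{pr}'}P_{f'}(\beta)=P_f\exists_{\mathrm{pr}}(\beta)$ for all $\beta\in P(X)$; (Frobenius) $\exists_{\mathrm{pr}}(P_{\mathrm{pr}}(\alpha)\wedge\beta)=\alpha\wedge\exists_{\mathrm{pr}}(\beta)$ for all $\alpha\in P(A)$, $\beta\in P(X)$. Existential completion: for a primary doctrine $P$, $P^e(A)$ is the poset reflection of the preorder of pairs $(g\colon B\to A,\ \alpha\in P(B))$ with $g$ a projection, where $(h\colon B\to A,\alpha)\le(f\colon D\to A,\gamma)$ iff there is $w\colon B\to D$ with $fw=h$ and $\alpha\le P_w(\gamma)$; for $f\colon A\to B$, $P^e_f(g\colon C\to B,\beta)=(f^*g,\ P_{g^*f}(\beta))$, with $f^*g\colon D\to A$, $g^*f\colon D\to C$ a pullback of $g$ along $f$. *)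

theory Defs
  imports "HOL-Algebra.Galois_Connection"
begin

section \<open>Categories with finite products\<close>

record ('o, 'm) cat =
  Obj :: "'o set"
  Arr :: "'m set"
  Dom :: "'m \<Rightarrow> 'o"
  Cod :: "'m \<Rightarrow> 'o"
  Ide :: "'o \<Rightarrow> 'm"
  Cmp :: "'m \<Rightarrow> 'm \<Rightarrow> 'm"  (infixr \<open>\<cdot>\<index>\<close> 75)

definition Hom :: "('o, 'm) cat \<Rightarrow> 'o \<Rightarrow> 'o \<Rightarrow> 'm set" where
  "Hom C A B = {f \<in> Arr C. Dom C f = A \<and> Cod C f = B}"

locale category =
  fixes C :: "('o, 'm) cat" (structure)
  assumes dom_obj: "f \<in> Arr C \<Longrightarrow> Dom C f \<in> Obj C"
    and cod_obj: "f \<in> Arr C \<Longrightarrow> Cod C f \<in> Obj C"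
    and ide_hom: "A \<in> Obj C \<Longrightarrow> Ide C A \<in> Hom C A A"
    and cmp_hom: "\<lbrakk>f \<in> Hom C A B; g \<in> Hom C B D\<rbrakk> \<Longrightarrow> g \<cdot> f \<in> Hom C A D"
    and cmp_ide_left: "f \<in> Hom C A B \<Longrightarrow> Ide C B \<cdot> f = f"
    and cmp_ide_right: "f \<in> Hom C A B \<Longrightarrow> f \<cdot> Ide C A = f"
    and cmp_assoc: "\<lbrakk>f \<in> Hom C A B; g \<in> Hom C B D; h \<in> Hom C D E\<rbrakk>
                      \<Longrightarrow> (h \<cdot> g) \<cdot> f = h \<cdot> (g \<cdot> f)"

definition is_terminal :: "('o, 'm) cat \<Rightarrow> 'o \<Rightarrow> bool" where
  "is_terminal C T \<longleftrightarrow> T \<in> Obj C \<and> (\<forall>Z \<in> Obj C. \<exists>!h. h \<in> Hom C Z T)"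

text \<open>Finite products are a property, not chosen structure: the apex of a product diagram
  is the common domain of its legs.\<close>

definition is_product :: "('o, 'm) cat \<Rightarrow> 'o \<Rightarrow> 'o \<Rightarrow> 'm \<Rightarrow> 'm \<Rightarrow> bool" where
  "is_product C A B p q \<longleftrightarrow>
     p \<in> Hom C (Dom C p) A \<and> q \<in> Hom C (Dom C p) B \<and>
     (\<forall>Z \<in> Obj C. \<forall>f \<in> Hom C Z A. \<forall>g \<in> Hom C Z B.
        \<exists>!h. h \<in> Hom C Z (Dom C p) \<and> p \<cdot>\<^bsub>C\<^esub> h = f \<and> q \<cdot>\<^bsub>C\<^esub> h = g)"

definition is_product3 ::
  "('o, 'm) cat \<Rightarrow> 'o \<Rightarrow> 'o \<Rightarrow> 'o \<Rightarrow> 'm \<Rightarrow> 'm \<Rightarrow> 'm \<Rightarrow> bool" where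
  "is_product3 C A B D p q r \<longleftrightarrow>
     p \<in> Hom C (Dom C p) A \<and> q \<in> Hom C (Dom C p) B \<and> r \<in> Hom C (Dom C p) D \<and>
     (\<forall>Z \<in> Obj C. \<forall>f \<in> Hom C Z A. \<forall>g \<in> Hom C Z B. \<forall>k \<in> Hom C Z D.
        \<exists>!h. h \<in> Hom C Z (Dom C p) \<and> p \<cdot>\<^bsub>C\<^esub> h = f \<and> q \<cdot>\<^bsub>C\<^esub> h = g \<and> r \<cdot>\<^bsub>C\<^esub> h = k)"

locale category_with_finite_products = category C for C :: "('o, 'm) cat" (structure) +
  assumes terminal_exists: "\<exists>T. is_terminal C T"
    and product_exists: "\<lbrakk>A \<in> Obj C; B \<in> Obj C\<rbrakk> \<Longrightarrow> \<exists>p q. is_product C A B p q"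

text \<open>The arrows \<open>\<langle>f, g\<rangle>\<close> and \<open>\<langle>f, g, k\<rangle>\<close> into the product diagrams with legs
  \<open>p, q\<close> and \<open>p, q, r\<close>; meaningful only if these are product diagrams.\<close>

definition pairing :: "('o, 'm) cat \<Rightarrow> 'm \<Rightarrow> 'm \<Rightarrow> 'm \<Rightarrow> 'm \<Rightarrow> 'm" where
  "pairing C p q f g =
     (THE h. h \<in> Hom C (Dom C f) (Dom C p) \<and> p \<cdot>\<^bsub>C\<^esub> h = f \<and> q \<cdot>\<^bsub>C\<^esub> h = g)"

definition tripling :: "('o, 'm) cat \<Rightarrow> 'm \<Rightarrow> 'm \<Rightarrow> 'm \<Rightarrow> 'm \<Rightarrow> 'm \<Rightarrow> 'm \<Rightarrow> 'm" where
  "tripling C p q r f g k =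
     (THE h. h \<in> Hom C (Dom C f) (Dom C p) \<and> p \<cdot>\<^bsub>C\<^esub> h = f \<and> q \<cdot>\<^bsub>C\<^esub> h = g \<and> r \<cdot>\<^bsub>C\<^esub> h = k)"

text \<open>As product diagrams are symmetric, it suffices to consider the first leg.\<close>

definition is_projection :: "('o, 'm) cat \<Rightarrow> 'm \<Rightarrow> bool" where
  "is_projection C p \<longleftrightarrow> (\<exists>B q. is_product C (Cod C p) B p q)"

text \<open>\<open>is_pullback C f g g' f'\<close>: the square \<open>f \<cdot> g' = g \<cdot> f'\<close> is a pullback of the cospan
  \<open>f, g\<close>, so that \<open>g'\<close> is \<open>f\<^sup>*g\<close> and \<open>f'\<close> is \<open>g\<^sup>*f\<close>.\<close>

definition is_pullback :: "('o, 'm) cat \<Rightarrow> 'm \<Rightarrow> 'm \<Rightarrow> 'm \<Rightarrow> 'm \<Rightarrow> bool" where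
  "is_pullback C f g g' f' \<longleftrightarrow>
     f \<in> Arr C \<and> g \<in> Hom C (Dom C g) (Cod C f) \<and>
     g' \<in> Hom C (Dom C g') (Dom C f) \<and> f' \<in> Hom C (Dom C g') (Dom C g) \<and>
     f \<cdot>\<^bsub>C\<^esub> g' = g \<cdot>\<^bsub>C\<^esub> f' \<and>
     (\<forall>Z \<in> Obj C. \<forall>u \<in> Hom C Z (Dom C f). \<forall>v \<in> Hom C Z (Dom C g).
        f \<cdot>\<^bsub>C\<^esub> u = g \<cdot>\<^bsub>C\<^esub> v \<longrightarrow>
        (\<exists>!h. h \<in> Hom C Z (Dom C g') \<and> g' \<cdot>\<^bsub>C\<^esub> h = u \<and> f' \<cdot>\<^bsub>C\<^esub> h = v))"


section \<open>Inf-semilattices\<close>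

locale inf_semilattice = lower_semilattice L + weak_partial_order_top L for L (structure)

definition InfSL_hom :: "'a gorder \<Rightarrow> 'b gorder \<Rightarrow> ('a \<Rightarrow> 'b) set" where
  "InfSL_hom L M = {h \<in> carrier L \<rightarrow> carrier M.
     h \<top>\<^bsub>L\<^esub> = \<top>\<^bsub>M\<^esub> \<and>
     (\<forall>x \<in> carrier L. \<forall>y \<in> carrier L. h (x \<sqinter>\<^bsub>L\<^esub> y) = h x \<sqinter>\<^bsub>M\<^esub> h y)}"

definition left_adjoint :: "'a gorder \<Rightarrow> 'b gorder \<Rightarrow> ('a \<Rightarrow> 'b) \<Rightarrow> ('b \<Rightarrow> 'a) \<Rightarrow> bool" where
  "left_adjoint L M l u \<longleftrightarrow>
     galois_connection \<lparr>orderA = L, orderB = M, lower = l, upper = u\<rparr>"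


section \<open>Doctrines\<close>

text \<open>\<open>fib P A\<close> is the fibre \<open>P(A)\<close> and \<open>rei P f\<close> the reindexing map \<open>P\<^sub>f\<close>.\<close>

record ('o, 'm, 'p) doctrine =
  fib :: "'o \<Rightarrow> 'p gorder"
  rei :: "'m \<Rightarrow> 'p \<Rightarrow> 'p"

locale primary_doctrine = category_with_finite_products C
  for C :: "('o, 'm) cat" (structure) +
  fixes P :: "('o, 'm, 'p) doctrine"
  assumes fib_inf_semilattice: "A \<in> Obj C \<Longrightarrow> inf_semilattice (fib P A)"
    and rei_hom: "f \<in> Hom C A B \<Longrightarrow> rei P f \<in> InfSL_hom (fib P B) (fib P A)"
    and rei_ide: "\<lbrakk>A \<in> Obj C; \<alpha> \<in> carrier (fib P A)\<rbrakk> \<Longrightarrow> rei P (Ide C A) \<alpha> = \<alpha>"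
    and rei_cmp: "\<lbrakk>f \<in> Hom C A B; g \<in> Hom C B D; \<alpha> \<in> carrier (fib P D)\<rbrakk>
                    \<Longrightarrow> rei P (g \<cdot> f) \<alpha> = rei P f (rei P g \<alpha>)"

text \<open>Here \<open>p1, p2\<close> are the projections of \<open>A \<times> A\<close>, \<open>q1, q2\<close> those of \<open>X \<times> A\<close>
  and \<open>r1, r2, r3\<close> those of \<open>X \<times> A \<times> A\<close>. All product diagrams are considered; as these are
  unique up to isomorphism, this amounts to fixing one choice of them.\<close>

locale elementary_doctrine = primary_doctrine C P
  for C :: "('o, 'm) cat" (structure) and P :: "('o, 'm, 'p) doctrine" +
  assumes elementary: "\<lbrakk>A \<in> Obj C; is_product C A A p1 p2\<rbrakk> \<Longrightarrow>
    \<exists>\<delta> \<in> carrier (fib P (Dom C p1)).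
      left_adjoint (fib P A) (fib P (Dom C p1))
        (\<lambda>\<alpha>. rei P p1 \<alpha> \<sqinter>\<^bsub>fib P (Dom C p1)\<^esub> \<delta>)
        (rei P (pairing C p1 p2 (Ide C A) (Ide C A))) \<and>
      (\<forall>X \<in> Obj C. \<forall>q1 q2 r1 r2 r3.
         is_product C X A q1 q2 \<longrightarrow> is_product3 C X A A r1 r2 r3 \<longrightarrow>
         left_adjoint (fib P (Dom C q1)) (fib P (Dom C r1))
           (\<lambda>\<alpha>. rei P (pairing C q1 q2 r1 r2) \<alpha>
                  \<sqinter>\<^bsub>fib P (Dom C r1)\<^esub> rei P (pairing C p1 p2 r2 r3) \<delta>)
           (rei P (tripling C r1 r2 r3 q1 q2 q2)))"

locale existential_doctrine = primary_doctrine C P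
  for C :: "('o, 'm) cat" (structure) and P :: "('o, 'm, 'p) doctrine" +
  assumes existential: "\<exists>Ex :: 'm \<Rightarrow> 'p \<Rightarrow> 'p.
    (\<forall>pr. is_projection C pr \<longrightarrow>
       left_adjoint (fib P (Dom C pr)) (fib P (Cod C pr)) (Ex pr) (rei P pr)) \<and>
    \<comment> \<open>Beck-Chevalley\<close>
    (\<forall>f pr pr' f'. is_pullback C f pr pr' f' \<longrightarrow> is_projection C pr \<longrightarrow> is_projection C pr' \<longrightarrow>
       (\<forall>\<beta> \<in> carrier (fib P (Dom C pr)). Ex pr' (rei P f' \<beta>) = rei P f (Ex pr \<beta>))) \<and>
    \<comment> \<open>Frobenius\<close>
    (\<forall>pr. is_projection C pr \<longrightarrow>
       (\<forall>\<alpha> \<in> carrier (fib P (Cod C pr)). \<forall>\<beta> \<in> carrier (fib P (Dom C pr)).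
          Ex pr (rei P pr \<alpha> \<sqinter>\<^bsub>fib P (Dom C pr)\<^esub> \<beta>) = \<alpha> \<sqinter>\<^bsub>fib P (Cod C pr)\<^esub> Ex pr \<beta>))"


section \<open>Existential completion\<close>

definition ex_pairs :: "('o, 'm) cat \<Rightarrow> ('o, 'm, 'p) doctrine \<Rightarrow> 'o \<Rightarrow> ('m \<times> 'p) set" where
  "ex_pairs C P A = {(g, \<alpha>). is_projection C g \<and> Cod C g = A \<and> \<alpha> \<in> carrier (fib P (Dom C g))}"

definition ex_le ::
  "('o, 'm) cat \<Rightarrow> ('o, 'm, 'p) doctrine \<Rightarrow> 'm \<times> 'p \<Rightarrow> 'm \<times> 'p \<Rightarrow> bool" where
  "ex_le C P = (\<lambda>(h, \<alpha>) (f, \<gamma>).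
     \<exists>w \<in> Hom C (Dom C h) (Dom C f). f \<cdot>\<^bsub>C\<^esub> w = h \<and> \<alpha> \<sqsubseteq>\<^bsub>fib P (Dom C h)\<^esub> rei P w \<gamma>)"

definition ex_equiv ::
  "('o, 'm) cat \<Rightarrow> ('o, 'm, 'p) doctrine \<Rightarrow> 'o \<Rightarrow> (('m \<times> 'p) \<times> ('m \<times> 'p)) set" where
  "ex_equiv C P A =
     {(x, y). x \<in> ex_pairs C P A \<and> y \<in> ex_pairs C P A \<and> ex_le C P x y \<and> ex_le C P y x}"

definition ex_fib :: "('o, 'm) cat \<Rightarrow> ('o, 'm, 'p) doctrine \<Rightarrow> 'o \<Rightarrow> ('m \<times> 'p) set gorder" where
  "ex_fib C P A =
     \<lparr>carrier = ex_pairs C P A // ex_equiv C P A,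
      eq = (=),
      le = (\<lambda>K L. \<exists>x \<in> K. \<exists>y \<in> L. ex_le C P x y)\<rparr>"

text \<open>Reindexing of a class \<open>K\<close> along \<open>f\<close>: the union of the classes of \<open>(f\<^sup>*g, P\<^sub>f\<^sub>' \<beta>)\<close> with
  \<open>f' = g\<^sup>*f\<close>, over all representatives \<open>(g, \<beta>)\<close> of \<open>K\<close> and all pullbacks of \<open>g\<close> along \<open>f\<close>.
  These classes all coincide, so that the union is the common class.\<close>

definition ex_rei ::
  "('o, 'm) cat \<Rightarrow> ('o, 'm, 'p) doctrine \<Rightarrow> 'm \<Rightarrow> ('m \<times> 'p) set \<Rightarrow> ('m \<times> 'p) set" where
  "ex_rei C P f K =
     (\<Union>(g, \<beta>) \<in> K. \<Union>(g', f') \<in> {(g', f'). is_pullback C f g g' f'}.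
        ex_equiv C P (Dom C f) `` {(g', rei P f' \<beta>)})"

definition existential_completion ::
  "('o, 'm) cat \<Rightarrow> ('o, 'm, 'p) doctrine \<Rightarrow> ('o, 'm, ('m \<times> 'p) set) doctrine" where
  "existential_completion C P = \<lparr>fib = ex_fib C P, rei = ex_rei C P\<rparr>"

end

theory Submission
  imports Defs
begin

text \<open>
The guiding idea is that \<open>P\<^sup>e\<close> is easier to handle as a fibration than fibre by fibre. For
  \<open>f\<close> from \<open>A\<close> to \<open>B\<close>, a pair \<open>(h, \<gamma>)\<close> over \<open>A\<close> lies below a pair \<open>(g, \<beta>)\<close> over \<open>B\<close>
  \<^emph>\<open>along\<close> \<open>f\<close> (\<open>ex_over\<close>) if some \<open>w\<close> satisfies \<open>g \<cdot> w = f \<cdot> h\<close> and \<open>\<gamma> \<le> P\<^sub>w \<beta>\<close>; no pullback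
  occurs in this condition. By the universal property of pullbacks it says precisely that
  \<open>(h, \<gamma>) \<le> P\<^sup>e\<^sub>f (g, \<beta>)\<close> (\<open>ex_over_pullback_iff\<close>, \<open>ex_le_rei_iff\<close>), so that equations between
  elements of \<open>P\<^sup>e\<close> can be proved by comparing what lies below them. Functoriality, tops and
  binary meets, and their preservation by reindexing all follow in this way.

  Left adjoints along a projection \<open>p\<close> are given by composition, \<open>(g, \<beta>) \<mapsto> (p \<cdot> g, \<beta>)\<close>: being below
  along the identity from \<open>p \<cdot> g\<close> is literally being below along \<open>p\<close> from \<open>g\<close>. Beck-Chevalley and
  Frobenius are both the pasting law for pullbacks (\<open>pullback_pasting\<close>).

  The equality predicate of \<open>P\<^sup>e\<close> on \<open>A\<close> is the class of \<open>(id, \<delta>)\<close> for the equality predicate \<open>\<delta>\<close>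
  of \<open>P\<close>. Write \<open>d = \<langle>pr\<^sub>1, pr\<^sub>2\<rangle>\<close> from \<open>X \<times> A \<times> A\<close> to \<open>X \<times> A\<close>, with section \<open>e\<close> the
  parametrised diagonal, and let \<open>g\<close> be a projection onto \<open>X \<times> A\<close>, say with domain \<open>X \<times> A \<times> B\<close>. Its
  pullback \<open>g'\<close> along \<open>d\<close> has domain \<open>X \<times> A \<times> A \<times> B\<close>, and the induced section \<open>e'\<close> is again a
  parametrised diagonal of \<open>A\<close>, now with parameter object \<open>X \<times> B\<close>. Hence elementarity of \<open>P\<close> gives
  the adjunction along \<open>e'\<close> (\<open>equality_predicate_over_projection\<close>). What remains is to compare
  witnesses: those for \<open>(g', \<dots>) \<le> (f, \<gamma>)\<close> are arrows \<open>w\<close> with \<open>f \<cdot> w = g'\<close>, those for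
  \<open>(g, \<beta>) \<le> P\<^sup>e\<^sub>e (f, \<gamma>)\<close> are arrows \<open>v\<close> with \<open>f \<cdot> v = e \<cdot> g\<close>, and \<open>w \<mapsto> w \<cdot> e'\<close> passes from the
  former to the latter. It is surjective because a projection \<open>f\<close> lifts against every split
  monomorphism (\<open>projection_lift\<close>): on the complementary factor of \<open>f\<close>, extend \<open>v\<close> along the
  retraction of \<open>e'\<close>. The unparametrised adjunction is the parametrised one with \<open>X\<close> terminal
  (\<open>equality_predicate_unparametrised\<close>).
\<close>


section \<open>Products and pullbacks\<close>

lemma Hom_iff: "f \<in> Hom C A B \<longleftrightarrow> f \<in> Arr C \<and> Dom C f = A \<and> Cod C f = B"
  by (auto simp: Hom_def)

context category
begin

lemma cmp_simps [simp]:
  assumes "f \<in> Arr C" "g \<in> Arr C" "Dom C g = Cod C f"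
  shows "g \<cdot> f \<in> Arr C" "Dom C (g \<cdot> f) = Dom C f" "Cod C (g \<cdot> f) = Cod C g"
  using cmp_hom[of f "Dom C f" "Cod C f" g "Cod C g"] assms by (auto simp: Hom_iff)

lemma assoc [simp]:
  assumes "f \<in> Arr C" "g \<in> Arr C" "h \<in> Arr C" "Dom C g = Cod C f" "Dom C h = Cod C g"
  shows "(h \<cdot> g) \<cdot> f = h \<cdot> (g \<cdot> f)"
  using cmp_assoc[of f "Dom C f" "Cod C f" g "Cod C g" h "Cod C h"] assms by (auto simp: Hom_iff)

text \<open>The simplifier brings composites into right-nested form, where the left-hand side of an equation
  \<open>h \<cdot> g = k\<close> is no longer a subterm of a longer composite \<open>h \<cdot> (g \<cdot> f)\<close>; this is the form of the
  equation that still rewrites it.\<close>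

lemma cmp_eq_extend:
  assumes "h \<cdot> g = k" "f \<in> Arr C" "g \<in> Arr C" "h \<in> Arr C" "Dom C g = Cod C f" "Dom C h = Cod C g"
  shows "h \<cdot> (g \<cdot> f) = k \<cdot> f"
  using assms assoc by metis

lemma ide_simps [simp]:
  assumes "A \<in> Obj C"
  shows "Ide C A \<in> Arr C" "Dom C (Ide C A) = A" "Cod C (Ide C A) = A"
  using ide_hom[OF assms] by (auto simp: Hom_iff)

lemma ide_cmp [simp]:
  assumes "f \<in> Arr C"
  shows "Cod C f = A \<Longrightarrow> Ide C A \<cdot> f = f" "Dom C f = B \<Longrightarrow> f \<cdot> Ide C B = f"
  using cmp_ide_left[of f] cmp_ide_right[of f] assms by (auto simp: Hom_iff)

lemma dom_cod_obj [simp]: "f \<in> Arr C \<Longrightarrow> Dom C f \<in> Obj C" "f \<in> Arr C \<Longrightarrow> Cod C f \<in> Obj C"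
  by (auto intro: dom_obj cod_obj)

lemma hom_dom_obj: "f \<in> Hom C A B \<Longrightarrow> A \<in> Obj C"
  by (auto simp: Hom_iff)

lemma terminal_unique:
  "\<lbrakk>is_terminal C T; h \<in> Hom C Z T; k \<in> Hom C Z T\<rbrakk> \<Longrightarrow> h = k"
  using hom_dom_obj[of h Z T] unfolding is_terminal_def by blast

lemma product_legs:
  assumes "is_product C A B p q"
  shows "p \<in> Arr C" "q \<in> Arr C" "Dom C q = Dom C p" "Cod C p = A" "Cod C q = B"
  using assms by (auto simp: is_product_def Hom_iff)

lemma product_arrow:
  assumes "is_product C A B p q" "f \<in> Hom C Z A" "g \<in> Hom C Z B"
  obtains h where "h \<in> Hom C Z (Dom C p)" "p \<cdot> h = f" "q \<cdot> h = g"
proof -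
  have "\<exists>!h. h \<in> Hom C Z (Dom C p) \<and> p \<cdot> h = f \<and> q \<cdot> h = g"
    using assms hom_dom_obj[OF assms(2)] by (simp add: is_product_def)
  then show ?thesis
    using that by blast
qed

lemma product_arrow_eqI:
  assumes "is_product C A B p q" "h \<in> Hom C Z (Dom C p)" "k \<in> Hom C Z (Dom C p)"
    and "p \<cdot> h = p \<cdot> k" "q \<cdot> h = q \<cdot> k"
  shows "h = k"
proof -
  have "Z \<in> Obj C" "p \<cdot> h \<in> Hom C Z A" "q \<cdot> h \<in> Hom C Z B"
    using assms(2) product_legs[OF assms(1)] by (auto simp: Hom_iff)
  then have "\<exists>!l. l \<in> Hom C Z (Dom C p) \<and> p \<cdot> l = p \<cdot> h \<and> q \<cdot> l = q \<cdot> h"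
    using assms(1) by (simp add: is_product_def)
  then show ?thesis
    using assms(2-) by auto
qed

lemma is_productI:
  assumes "p \<in> Hom C D A" "q \<in> Hom C D B"
    and "\<And>Z f g. \<lbrakk>f \<in> Hom C Z A; g \<in> Hom C Z B\<rbrakk> \<Longrightarrow> \<exists>h \<in> Hom C Z D. p \<cdot> h = f \<and> q \<cdot> h = g"
    and "\<And>Z h k. \<lbrakk>h \<in> Hom C Z D; k \<in> Hom C Z D; p \<cdot> h = p \<cdot> k; q \<cdot> h = q \<cdot> k\<rbrakk> \<Longrightarrow> h = k"
  shows "is_product C A B p q"
proof -
  have D: "Dom C p = D"
    using assms(1) by (simp add: Hom_iff)
  show ?thesis
    unfolding is_product_def D
  proof (intro conjI ballI assms(1,2))
    fix Z f g
    assume "f \<in> Hom C Z A" "g \<in> Hom C Z B"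
    from assms(3)[OF this] obtain h where h: "h \<in> Hom C Z D" "p \<cdot> h = f" "q \<cdot> h = g"
      by blast
    show "\<exists>!h. h \<in> Hom C Z D \<and> p \<cdot> h = f \<and> q \<cdot> h = g"
      by (rule ex1I[of _ h]; (rule assms(4)[of _ Z])?; simp add: h)
  qed
qed

lemma pairing_eqI:
  assumes "is_product C A B p q" "h \<in> Hom C Z (Dom C p)" "p \<cdot> h = f" "q \<cdot> h = g"
  shows "pairing C p q f g = h"
proof -
  have Z: "Dom C f = Z"
    using assms product_legs[OF assms(1)] by (auto simp: Hom_iff)
  show ?thesis
    unfolding pairing_def Z
    by (intro the_equality; (rule product_arrow_eqI[OF assms(1), where Z = Z])?; simp add: assms)
qed

lemma product3_legs:
  assumes "is_product3 C A B D p q r"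
  shows "p \<in> Arr C" "q \<in> Arr C" "r \<in> Arr C" "Dom C q = Dom C p" "Dom C r = Dom C p"
    "Cod C p = A" "Cod C q = B" "Cod C r = D"
  using assms by (auto simp: is_product3_def Hom_iff)

lemma product3_arrow:
  assumes "is_product3 C A B D p q r" "f \<in> Hom C Z A" "g \<in> Hom C Z B" "k \<in> Hom C Z D"
  obtains h where "h \<in> Hom C Z (Dom C p)" "p \<cdot> h = f" "q \<cdot> h = g" "r \<cdot> h = k"
proof -
  have "\<exists>!h. h \<in> Hom C Z (Dom C p) \<and> p \<cdot> h = f \<and> q \<cdot> h = g \<and> r \<cdot> h = k"
    using assms hom_dom_obj[OF assms(2)] by (simp add: is_product3_def)
  then show ?thesis
    using that by blast
qed

lemma product3_arrow_eqI:
  assumes "is_product3 C A B D p q r" "h \<in> Hom C Z (Dom C p)" "k \<in> Hom C Z (Dom C p)"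
    and "p \<cdot> h = p \<cdot> k" "q \<cdot> h = q \<cdot> k" "r \<cdot> h = r \<cdot> k"
  shows "h = k"
proof -
  have "Z \<in> Obj C" "p \<cdot> h \<in> Hom C Z A" "q \<cdot> h \<in> Hom C Z B" "r \<cdot> h \<in> Hom C Z D"
    using assms(2) product3_legs[OF assms(1)] by (auto simp: Hom_iff)
  then have "\<exists>!l. l \<in> Hom C Z (Dom C p) \<and> p \<cdot> l = p \<cdot> h \<and> q \<cdot> l = q \<cdot> h \<and> r \<cdot> l = r \<cdot> h"
    using assms(1) by (simp add: is_product3_def)
  then show ?thesis
    using assms(2-) by auto
qed

lemma is_product3I:
  assumes "p \<in> Hom C E A" "q \<in> Hom C E B" "r \<in> Hom C E D"
    and "\<And>Z f g k. \<lbrakk>f \<in> Hom C Z A; g \<in> Hom C Z B; k \<in> Hom C Z D\<rbrakk>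
           \<Longrightarrow> \<exists>h \<in> Hom C Z E. p \<cdot> h = f \<and> q \<cdot> h = g \<and> r \<cdot> h = k"
    and "\<And>Z h k. \<lbrakk>h \<in> Hom C Z E; k \<in> Hom C Z E; p \<cdot> h = p \<cdot> k; q \<cdot> h = q \<cdot> k; r \<cdot> h = r \<cdot> k\<rbrakk>
           \<Longrightarrow> h = k"
  shows "is_product3 C A B D p q r"
proof -
  have E: "Dom C p = E"
    using assms(1) by (simp add: Hom_iff)
  show ?thesis
    unfolding is_product3_def E
  proof (intro conjI ballI assms(1,2,3))
    fix Z f g k
    assume "f \<in> Hom C Z A" "g \<in> Hom C Z B" "k \<in> Hom C Z D"
    from assms(4)[OF this] obtain h
      where h: "h \<in> Hom C Z E" "p \<cdot> h = f" "q \<cdot> h = g" "r \<cdot> h = k"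
      by blast
    show "\<exists>!h. h \<in> Hom C Z E \<and> p \<cdot> h = f \<and> q \<cdot> h = g \<and> r \<cdot> h = k"
      by (rule ex1I[of _ h]; (rule assms(5)[of _ Z])?; simp add: h)
  qed
qed

lemma tripling_eqI:
  assumes "is_product3 C A B D p q r" "h \<in> Hom C Z (Dom C p)"
    and "p \<cdot> h = f" "q \<cdot> h = g" "r \<cdot> h = k"
  shows "tripling C p q r f g k = h"
proof -
  have Z: "Dom C f = Z"
    using assms product3_legs[OF assms(1)] by (auto simp: Hom_iff)
  show ?thesis
    unfolding tripling_def Z
    by (intro the_equality; (rule product3_arrow_eqI[OF assms(1), where Z = Z])?; simp add: assms)
qed

lemma pullback_legs:
  assumes "is_pullback C f g g' f'"
  shows "f \<in> Arr C" "g \<in> Arr C" "g' \<in> Arr C" "f' \<in> Arr C" "Cod C g = Cod C f"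
    "Cod C g' = Dom C f" "Cod C f' = Dom C g" "Dom C f' = Dom C g'" "f \<cdot> g' = g \<cdot> f'"
  using assms by (auto simp: is_pullback_def Hom_iff)

lemma pullback_arrow:
  assumes "is_pullback C f g g' f'" "u \<in> Hom C Z (Dom C f)" "v \<in> Hom C Z (Dom C g)"
    and "f \<cdot> u = g \<cdot> v"
  obtains h where "h \<in> Hom C Z (Dom C g')" "g' \<cdot> h = u" "f' \<cdot> h = v"
proof -
  have "\<exists>!h. h \<in> Hom C Z (Dom C g') \<and> g' \<cdot> h = u \<and> f' \<cdot> h = v"
    using assms hom_dom_obj[OF assms(2)] by (simp add: is_pullback_def)
  then show ?thesis
    using that by blast
qed

lemma pullback_arrow_eqI:
  assumes "is_pullback C f g g' f'" "h \<in> Hom C Z (Dom C g')" "k \<in> Hom C Z (Dom C g')"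
    and "g' \<cdot> h = g' \<cdot> k" "f' \<cdot> h = f' \<cdot> k"
  shows "h = k"
proof -
  note legs = pullback_legs[OF assms(1)]
  have "Z \<in> Obj C" "g' \<cdot> h \<in> Hom C Z (Dom C f)" "f' \<cdot> h \<in> Hom C Z (Dom C g)"
    using assms(2) legs by (auto simp: Hom_iff)
  moreover have "f \<cdot> (g' \<cdot> h) = g \<cdot> (f' \<cdot> h)"
    using assms(2) legs by (metis Hom_iff assoc)
  ultimately have "\<exists>!l. l \<in> Hom C Z (Dom C g') \<and> g' \<cdot> l = g' \<cdot> h \<and> f' \<cdot> l = f' \<cdot> h"
    using assms(1) by (simp add: is_pullback_def)
  then show ?thesis
    using assms(2-) by auto
qed

lemma is_pullbackI:
  assumes "f \<in> Arr C" "g \<in> Arr C" "Cod C g = Cod C f"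
    and "g' \<in> Hom C D (Dom C f)" "f' \<in> Hom C D (Dom C g)" "f \<cdot> g' = g \<cdot> f'"
    and "\<And>Z u v. \<lbrakk>u \<in> Hom C Z (Dom C f); v \<in> Hom C Z (Dom C g); f \<cdot> u = g \<cdot> v\<rbrakk>
           \<Longrightarrow> \<exists>h \<in> Hom C Z D. g' \<cdot> h = u \<and> f' \<cdot> h = v"
    and "\<And>Z h k. \<lbrakk>h \<in> Hom C Z D; k \<in> Hom C Z D; g' \<cdot> h = g' \<cdot> k; f' \<cdot> h = f' \<cdot> k\<rbrakk> \<Longrightarrow> h = k"
  shows "is_pullback C f g g' f'"
proof -
  have D: "Dom C g' = D"
    using assms(4) by (simp add: Hom_iff)
  show ?thesis
    unfolding is_pullback_def D
  proof (intro conjI ballI impI assms(1,4,5,6))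
    show "g \<in> Hom C (Dom C g) (Cod C f)"
      using assms(2,3) by (simp add: Hom_iff)
    fix Z u v
    assume "u \<in> Hom C Z (Dom C f)" "v \<in> Hom C Z (Dom C g)" "f \<cdot> u = g \<cdot> v"
    from assms(7)[OF this] obtain h where h: "h \<in> Hom C Z D" "g' \<cdot> h = u" "f' \<cdot> h = v"
      by blast
    show "\<exists>!h. h \<in> Hom C Z D \<and> g' \<cdot> h = u \<and> f' \<cdot> h = v"
      by (rule ex1I[of _ h]; (rule assms(8)[of _ Z])?; simp add: h)
  qed
qed

lemma is_pullback_sym:
  assumes "is_pullback C f g g' f'"
  shows "is_pullback C g f f' g'"
proof -
  note legs = pullback_legs[OF assms]
  show ?thesis
  proof (rule is_pullbackI[where D = "Dom C g'"])
    fix Z u v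
    assume "u \<in> Hom C Z (Dom C g)" "v \<in> Hom C Z (Dom C f)" "g \<cdot> u = f \<cdot> v"
    then show "\<exists>h \<in> Hom C Z (Dom C g'). f' \<cdot> h = u \<and> g' \<cdot> h = v"
      using pullback_arrow[OF assms] by metis
  next
    fix Z h k
    assume "h \<in> Hom C Z (Dom C g')" "k \<in> Hom C Z (Dom C g')" "f' \<cdot> h = f' \<cdot> k" "g' \<cdot> h = g' \<cdot> k"
    then show "h = k"
      by - (rule pullback_arrow_eqI[OF assms])
  qed (use legs in \<open>auto simp: Hom_iff\<close>)
qed

lemma pullback_along_ide:
  "g \<in> Arr C \<Longrightarrow> is_pullback C (Ide C (Cod C g)) g g (Ide C (Dom C g))"
  by (rule is_pullbackI[where D = "Dom C g"]) (auto simp: Hom_iff)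

lemma pullback_pasting:
  assumes 1: "is_pullback C f g g' f'" and 2: "is_pullback C k g' g'' k'"
  shows "is_pullback C (f \<cdot> k) g g'' (f' \<cdot> k')"
proof -
  note legs = pullback_legs[OF 1] pullback_legs[OF 2]
  show ?thesis
  proof (rule is_pullbackI[where D = "Dom C g''"])
    show "(f \<cdot> k) \<cdot> g'' = g \<cdot> (f' \<cdot> k')"
      using legs by (simp add: cmp_eq_extend[OF legs(9)])
  next
    fix Z u v
    assume *: "u \<in> Hom C Z (Dom C (f \<cdot> k))" "v \<in> Hom C Z (Dom C g)" "(f \<cdot> k) \<cdot> u = g \<cdot> v"
    then have u: "u \<in> Hom C Z (Dom C k)" "k \<cdot> u \<in> Hom C Z (Dom C f)" "f \<cdot> (k \<cdot> u) = g \<cdot> v"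
      using legs by (auto simp: Hom_iff)
    obtain l where l: "l \<in> Hom C Z (Dom C g')" "g' \<cdot> l = k \<cdot> u" "f' \<cdot> l = v"
      using pullback_arrow[OF 1 u(2) *(2) u(3)] .
    obtain h where h: "h \<in> Hom C Z (Dom C g'')" "g'' \<cdot> h = u" "k' \<cdot> h = l"
      using pullback_arrow[OF 2 u(1) l(1) l(2)[symmetric]] .
    show "\<exists>h \<in> Hom C Z (Dom C g''). g'' \<cdot> h = u \<and> (f' \<cdot> k') \<cdot> h = v"
      using h l legs by (intro bexI[of _ h]) (auto simp: Hom_iff)
  next
    fix Z h l
    assume *: "h \<in> Hom C Z (Dom C g'')" "l \<in> Hom C Z (Dom C g'')" "g'' \<cdot> h = g'' \<cdot> l"
      "(f' \<cdot> k') \<cdot> h = (f' \<cdot> k') \<cdot> l"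
    have "k' \<cdot> h = k' \<cdot> l"
    proof (rule pullback_arrow_eqI[OF 1])
      have "g' \<cdot> (k' \<cdot> h) = k \<cdot> (g'' \<cdot> h)" "g' \<cdot> (k' \<cdot> l) = k \<cdot> (g'' \<cdot> l)"
        using *(1,2) legs by (metis Hom_iff assoc)+
      then show "g' \<cdot> (k' \<cdot> h) = g' \<cdot> (k' \<cdot> l)"
        using *(3) by simp
    qed (use * legs in \<open>auto simp: Hom_iff\<close>)
    with * show "h = l"
      by - (rule pullback_arrow_eqI[OF 2])
  qed (use legs in \<open>auto simp: Hom_iff\<close>)
qed

lemma projection_arr: "is_projection C g \<Longrightarrow> g \<in> Arr C"
  by (auto simp: is_projection_def is_product_def Hom_iff)

text \<open>Pulling back \<open>A \<times> B \<rightarrow> A\<close> along \<open>A' \<rightarrow> A\<close> gives \<open>A' \<times> B \<rightarrow> A'\<close>: the complementary factor is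
  unchanged, and its projection is \<open>q \<cdot> f'\<close>.\<close>

lemma projection_pullback:
  assumes "is_pullback C f g g' f'" "is_projection C g"
  shows "is_projection C g'"
proof -
  note legs = pullback_legs[OF assms(1)]
  obtain B q where q: "is_product C (Cod C g) B g q"
    using assms(2) by (auto simp: is_projection_def)
  note q_legs = product_legs[OF q]
  have "is_product C (Cod C g') B g' (q \<cdot> f')"
  proof (rule is_productI[where D = "Dom C g'"])
    fix Z u v
    assume *: "u \<in> Hom C Z (Cod C g')" "v \<in> Hom C Z B"
    then have fu: "f \<cdot> u \<in> Hom C Z (Cod C g)"
      using legs by (auto simp: Hom_iff)
    obtain w where w: "w \<in> Hom C Z (Dom C g)" "g \<cdot> w = f \<cdot> u" "q \<cdot> w = v"
      using product_arrow[OF q fu *(2)] .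
    obtain h where h: "h \<in> Hom C Z (Dom C g')" "g' \<cdot> h = u" "f' \<cdot> h = w"
      using pullback_arrow[OF assms(1) _ w(1) w(2)[symmetric]] *(1) legs by metis
    then show "\<exists>h \<in> Hom C Z (Dom C g'). g' \<cdot> h = u \<and> (q \<cdot> f') \<cdot> h = v"
      using w legs q_legs by (intro bexI[of _ h]) (auto simp: Hom_iff)
  next
    fix Z h k
    assume *: "h \<in> Hom C Z (Dom C g')" "k \<in> Hom C Z (Dom C g')" "g' \<cdot> h = g' \<cdot> k"
      "(q \<cdot> f') \<cdot> h = (q \<cdot> f') \<cdot> k"
    have "f' \<cdot> h = f' \<cdot> k"
    proof (rule product_arrow_eqI[OF q])
      have "g \<cdot> (f' \<cdot> h) = f \<cdot> (g' \<cdot> h)" "g \<cdot> (f' \<cdot> k) = f \<cdot> (g' \<cdot> k)"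
        using *(1,2) legs by (metis Hom_iff assoc)+
      then show "g \<cdot> (f' \<cdot> h) = g \<cdot> (f' \<cdot> k)"
        using *(3) by simp
    qed (use * legs q_legs in \<open>auto simp: Hom_iff\<close>)
    with * show "h = k"
      by - (rule pullback_arrow_eqI[OF assms(1)])
  qed (use legs q_legs in \<open>auto simp: Hom_iff\<close>)
  then show ?thesis
    by (auto simp: is_projection_def)
qed

text \<open>Projections have the right lifting property against split monomorphisms. The lift has first
  component \<open>u\<close>, as required, and second component that of \<open>v \<cdot> r\<close>, which restricts along \<open>e\<close> to
  that of \<open>v\<close> because \<open>r\<close> retracts \<open>e\<close>.\<close>

lemma projection_lift:
  assumes f: "is_projection C f" "f \<in> Hom C D A"
    and e: "e \<in> Hom C Z' Z" and r: "r \<in> Hom C Z Z'" "r \<cdot> e = Ide C Z'"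
    and u: "u \<in> Hom C Z A" and v: "v \<in> Hom C Z' D" and eq: "f \<cdot> v = u \<cdot> e"
  obtains w where "w \<in> Hom C Z D" "f \<cdot> w = u" "w \<cdot> e = v"
proof -
  obtain B q where q: "is_product C A B f q"
    using f by (auto simp: is_projection_def Hom_iff)
  note legs = product_legs[OF q]
  have "q \<cdot> (v \<cdot> r) \<in> Hom C Z B"
    using legs f v r by (auto simp: Hom_iff)
  then obtain w where w: "w \<in> Hom C Z D" "f \<cdot> w = u" "q \<cdot> w = q \<cdot> (v \<cdot> r)"
    using product_arrow[OF q u] f(2) by (metis Hom_iff)
  have "w \<cdot> e = v"
  proof (rule product_arrow_eqI[OF q])
    show "f \<cdot> (w \<cdot> e) = f \<cdot> v"
      using w(1) e legs f(2) eq cmp_eq_extend[OF w(2)] by (simp add: Hom_iff)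
    have "v \<cdot> (r \<cdot> e) = v"
      using r v by (simp add: Hom_iff)
    then show "q \<cdot> (w \<cdot> e) = q \<cdot> v"
      using w(1) e r(1) v legs f(2) cmp_eq_extend[OF w(3)] by (simp add: Hom_iff)
  qed (use w e v f(2) legs in \<open>auto simp: Hom_iff\<close>)
  with w show ?thesis
    using that by blast
qed

end

context category_with_finite_products
begin

text \<open>The complementary factor of an identity is a terminal object.\<close>

lemma projection_ide:
  assumes "A \<in> Obj C"
  shows "is_projection C (Ide C A)"
proof -
  obtain T where T: "is_terminal C T"
    using terminal_exists by blast
  then obtain t where t: "t \<in> Hom C A T"
    using assms unfolding is_terminal_def by blast
  have "is_product C A T (Ide C A) t"
  proof (rule is_productI[where D = A])
    fix Z f g
    assume *: "f \<in> Hom C Z A" "g \<in> Hom C Z T"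
    have "t \<cdot> f = g"
      by (rule terminal_unique[OF T, where Z = Z]) (use * t in \<open>auto simp: Hom_iff\<close>)
    then show "\<exists>h \<in> Hom C Z A. Ide C A \<cdot> h = f \<and> t \<cdot> h = g"
      using * by (intro bexI[of _ f]) (auto simp: Hom_iff)
  qed (use assms t in \<open>auto simp: Hom_iff\<close>)
  then show ?thesis
    using assms by (auto simp: is_projection_def)
qed

text \<open>The complementary factor of a composite \<open>A \<times> B \<times> D \<rightarrow> A \<times> B \<rightarrow> A\<close> is \<open>B \<times> D\<close>.\<close>

lemma projection_cmp:
  assumes "is_projection C f" "is_projection C g" "Dom C f = Cod C g"
  shows "is_projection C (f \<cdot> g)"
proof -
  obtain B q where q: "is_product C (Cod C f) B f q"
    using assms(1) by (auto simp: is_projection_def)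
  obtain D s where s: "is_product C (Cod C g) D g s"
    using assms(2) by (auto simp: is_projection_def)
  note legs = product_legs[OF q] product_legs[OF s] assms(3)
  obtain x y where xy: "is_product C B D x y"
    using product_exists legs by (metis dom_cod_obj(2))
  note xy_legs = product_legs[OF xy]
  have "q \<cdot> g \<in> Hom C (Dom C g) B" "s \<in> Hom C (Dom C g) D"
    using legs by (auto simp: Hom_iff)
  then obtain t where t: "t \<in> Hom C (Dom C g) (Dom C x)" "x \<cdot> t = q \<cdot> g" "y \<cdot> t = s"
    using product_arrow[OF xy] by metis
  have "is_product C (Cod C f) (Dom C x) (f \<cdot> g) t"
  proof (rule is_productI[where D = "Dom C g"])
    fix Z u v
    assume *: "u \<in> Hom C Z (Cod C f)" "v \<in> Hom C Z (Dom C x)"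
    then have v: "x \<cdot> v \<in> Hom C Z B" "y \<cdot> v \<in> Hom C Z D"
      using xy_legs by (auto simp: Hom_iff)
    obtain a where a: "a \<in> Hom C Z (Cod C g)" "f \<cdot> a = u" "q \<cdot> a = x \<cdot> v"
      using product_arrow[OF q *(1) v(1)] legs by metis
    obtain h where h: "h \<in> Hom C Z (Dom C g)" "g \<cdot> h = a" "s \<cdot> h = y \<cdot> v"
      using product_arrow[OF s a(1) v(2)] .
    have "t \<cdot> h = v"
    proof (rule product_arrow_eqI[OF xy])
      show "x \<cdot> (t \<cdot> h) = x \<cdot> v" "y \<cdot> (t \<cdot> h) = y \<cdot> v"
        using t a h legs xy_legs cmp_eq_extend[OF t(2)] cmp_eq_extend[OF t(3)]
        by (auto simp: Hom_iff)
    qed (use t h * in \<open>auto simp: Hom_iff\<close>)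
    then show "\<exists>h \<in> Hom C Z (Dom C g). (f \<cdot> g) \<cdot> h = u \<and> t \<cdot> h = v"
      using a h legs by (intro bexI[of _ h]) (auto simp: Hom_iff)
  next
    fix Z h k
    assume *: "h \<in> Hom C Z (Dom C g)" "k \<in> Hom C Z (Dom C g)" "(f \<cdot> g) \<cdot> h = (f \<cdot> g) \<cdot> k"
      "t \<cdot> h = t \<cdot> k"
    have xk: "q \<cdot> (g \<cdot> l) = x \<cdot> (t \<cdot> l)" "s \<cdot> l = y \<cdot> (t \<cdot> l)" if "l \<in> Hom C Z (Dom C g)" for l
      using that t(1) legs xy_legs cmp_eq_extend[OF t(2)] cmp_eq_extend[OF t(3)]
      by (auto simp: Hom_iff)
    have gh: "g \<cdot> h = g \<cdot> k"
      by (rule product_arrow_eqI[OF q]) (use * xk legs in \<open>auto simp: Hom_iff\<close>)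
    show "h = k"
      by (rule product_arrow_eqI[OF s, where Z = Z]) (use * xk gh in auto)
  qed (use t legs in \<open>auto simp: Hom_iff\<close>)
  then show ?thesis
    using legs by (auto simp: is_projection_def)
qed

lemma projection_pullback_exists:
  assumes "is_projection C g" "f \<in> Hom C A (Cod C g)"
  obtains g' f' where "is_pullback C f g g' f'"
proof -
  obtain B q where q: "is_product C (Cod C g) B g q"
    using assms(1) by (auto simp: is_projection_def)
  note legs = product_legs[OF q]
  obtain x y where xy: "is_product C A B x y"
    using product_exists legs assms(2) by (metis Hom_iff dom_cod_obj)
  note xy_legs = product_legs[OF xy]
  have "f \<cdot> x \<in> Hom C (Dom C x) (Cod C g)" "y \<in> Hom C (Dom C x) B"
    using xy_legs assms(2) by (auto simp: Hom_iff)
  then obtain f' where f': "f' \<in> Hom C (Dom C x) (Dom C g)" "g \<cdot> f' = f \<cdot> x" "q \<cdot> f' = y"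
    using product_arrow[OF q] by metis
  have "is_pullback C f g x f'"
  proof (rule is_pullbackI[where D = "Dom C x"])
    fix Z u v
    assume *: "u \<in> Hom C Z (Dom C f)" "v \<in> Hom C Z (Dom C g)" "f \<cdot> u = g \<cdot> v"
    then have u: "u \<in> Hom C Z A" "q \<cdot> v \<in> Hom C Z B"
      using legs assms(2) by (auto simp: Hom_iff)
    obtain h where h: "h \<in> Hom C Z (Dom C x)" "x \<cdot> h = u" "y \<cdot> h = q \<cdot> v"
      using product_arrow[OF xy u] .
    have "f' \<cdot> h = v"
    proof (rule product_arrow_eqI[OF q])
      show "g \<cdot> (f' \<cdot> h) = g \<cdot> v" "q \<cdot> (f' \<cdot> h) = q \<cdot> v"
        using f'(1) h * legs xy_legs assms(2) cmp_eq_extend[OF f'(2)] cmp_eq_extend[OF f'(3)]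
        by (auto simp: Hom_iff)
    qed (use f' h * in \<open>auto simp: Hom_iff\<close>)
    with h show "\<exists>h \<in> Hom C Z (Dom C x). x \<cdot> h = u \<and> f' \<cdot> h = v"
      by auto
  next
    fix Z h k
    assume *: "h \<in> Hom C Z (Dom C x)" "k \<in> Hom C Z (Dom C x)" "x \<cdot> h = x \<cdot> k" "f' \<cdot> h = f' \<cdot> k"
    have y: "y \<cdot> l = q \<cdot> (f' \<cdot> l)" if "l \<in> Hom C Z (Dom C x)" for l
      using that f'(1) legs cmp_eq_extend[OF f'(3)] by (auto simp: Hom_iff)
    show "h = k"
      by (rule product_arrow_eqI[OF xy, where Z = Z]) (use * y in auto)
  qed (use f' legs xy_legs assms(2) in \<open>auto simp: Hom_iff\<close>)
  then show ?thesis
    using that by blast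
qed

end


section \<open>Fibres and reindexing\<close>

context inf_semilattice
begin

lemma le_meet_iff:
  assumes "x \<in> carrier L" "y \<in> carrier L" "z \<in> carrier L"
  shows "z \<sqsubseteq> x \<sqinter> y \<longleftrightarrow> z \<sqsubseteq> x \<and> z \<sqsubseteq> y"
proof -
  have "x \<sqinter> y \<in> carrier L" "x \<sqinter> y \<sqsubseteq> x" "x \<sqinter> y \<sqsubseteq> y"
    using assms by (simp_all add: meet_left meet_right)
  then show ?thesis
    using assms le_trans[of z "x \<sqinter> y" x] le_trans[of z "x \<sqinter> y" y] meet_le[of z x y] by metis
qed

lemma meet_eqI:
  assumes "x \<in> carrier L" "y \<in> carrier L" "m \<in> carrier L"
    and "\<And>z. z \<in> carrier L \<Longrightarrow> z \<sqsubseteq> m \<longleftrightarrow> z \<sqsubseteq> x \<and> z \<sqsubseteq> y"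
  shows "x \<sqinter> y = m"
proof (rule le_antisym)
  show c: "x \<sqinter> y \<in> carrier L" "m \<in> carrier L"
    using assms by simp_all
  show "m \<sqsubseteq> x \<sqinter> y" "x \<sqinter> y \<sqsubseteq> m"
    using le_meet_iff[OF assms(1,2)] assms(4) c le_refl by metis+
qed

end

text \<open>In a partial order, an element with the lower bounds of \<open>x\<close> and \<open>y\<close> as its lower set is their
  meet. This form lets meets of the completion be verified by comparing lower sets.\<close>

lemma inf_semilatticeI:
  assumes "partial_order L"
    and "\<exists>t \<in> carrier L. \<forall>x \<in> carrier L. x \<sqsubseteq>\<^bsub>L\<^esub> t"
    and "\<And>x y. \<lbrakk>x \<in> carrier L; y \<in> carrier L\<rbrakk> \<Longrightarrow>
           \<exists>m \<in> carrier L. \<forall>z \<in> carrier L. z \<sqsubseteq>\<^bsub>L\<^esub> m \<longleftrightarrow> z \<sqsubseteq>\<^bsub>L\<^esub> x \<and> z \<sqsubseteq>\<^bsub>L\<^esub> y"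
  shows "inf_semilattice L"
proof -
  interpret partial_order L
    by fact
  show ?thesis
  proof
    show "\<exists>t. greatest L t (carrier L)"
      using assms(2) by (auto simp: greatest_def)
    fix x y
    assume xy: "x \<in> carrier L" "y \<in> carrier L"
    obtain m where m: "m \<in> carrier L"
      "\<And>z. z \<in> carrier L \<Longrightarrow> z \<sqsubseteq>\<^bsub>L\<^esub> m \<longleftrightarrow> z \<sqsubseteq>\<^bsub>L\<^esub> x \<and> z \<sqsubseteq>\<^bsub>L\<^esub> y"
      using assms(3)[OF xy] by blast
    from m(2)[OF m(1)] have "m \<sqsubseteq>\<^bsub>L\<^esub> x" "m \<sqsubseteq>\<^bsub>L\<^esub> y"
      using le_refl[OF m(1)] by simp_all
    then have "greatest L m (Lower L {x, y})"
      using m xy by (auto simp: greatest_def Lower_def)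
    then show "\<exists>m. greatest L m (Lower L {x, y})"
      by blast
  qed
qed

lemma left_adjointI:
  assumes "partial_order L" "partial_order M"
    and "\<And>x. x \<in> carrier L \<Longrightarrow> l x \<in> carrier M" "\<And>y. y \<in> carrier M \<Longrightarrow> u y \<in> carrier L"
    and "\<And>x y. \<lbrakk>x \<in> carrier L; y \<in> carrier M\<rbrakk> \<Longrightarrow> l x \<sqsubseteq>\<^bsub>M\<^esub> y \<longleftrightarrow> x \<sqsubseteq>\<^bsub>L\<^esub> u y"
  shows "left_adjoint L M l u"
  using assms unfolding left_adjoint_def
  by (auto simp: galois_connection_def connection_def galois_connection_axioms_def)

lemma left_adjointD:
  "\<lbrakk>left_adjoint L M l u; x \<in> carrier L; y \<in> carrier M\<rbrakk> \<Longrightarrow> l x \<sqsubseteq>\<^bsub>M\<^esub> y \<longleftrightarrow> x \<sqsubseteq>\<^bsub>L\<^esub> u y"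
  unfolding left_adjoint_def by (drule galois_connection.galois_property) auto

context primary_doctrine
begin

lemma fib_partial_order: "A \<in> Obj C \<Longrightarrow> partial_order (fib P A)"
  using fib_inf_semilattice by (simp add: inf_semilattice_def lower_semilattice_def)

lemma fib_refl:
  "\<lbrakk>A \<in> Obj C; \<alpha> \<in> carrier (fib P A)\<rbrakk> \<Longrightarrow> \<alpha> \<sqsubseteq>\<^bsub>fib P A\<^esub> \<alpha>"
  by (rule weak_partial_order.le_refl[OF partial_order.axioms(1)[OF fib_partial_order]])

lemma fib_trans:
  assumes "\<alpha> \<sqsubseteq>\<^bsub>fib P A\<^esub> \<beta>" "\<beta> \<sqsubseteq>\<^bsub>fib P A\<^esub> \<gamma>" "A \<in> Obj C"
    "\<alpha> \<in> carrier (fib P A)" "\<beta> \<in> carrier (fib P A)" "\<gamma> \<in> carrier (fib P A)"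
  shows "\<alpha> \<sqsubseteq>\<^bsub>fib P A\<^esub> \<gamma>"
  by (rule weak_partial_order.le_trans[OF partial_order.axioms(1)[OF fib_partial_order] assms(1,2)])
    (use assms in auto)

lemma fib_meet_closed [simp]:
  assumes "A \<in> Obj C" "\<alpha> \<in> carrier (fib P A)" "\<beta> \<in> carrier (fib P A)"
  shows "\<alpha> \<sqinter>\<^bsub>fib P A\<^esub> \<beta> \<in> carrier (fib P A)"
proof -
  interpret inf_semilattice "fib P A"
    using assms(1) by (rule fib_inf_semilattice)
  show ?thesis
    using assms by simp
qed

lemma fib_le_meet_iff:
  assumes "A \<in> Obj C" "\<alpha> \<in> carrier (fib P A)" "\<beta> \<in> carrier (fib P A)" "\<gamma> \<in> carrier (fib P A)"
  shows "\<gamma> \<sqsubseteq>\<^bsub>fib P A\<^esub> \<alpha> \<sqinter>\<^bsub>fib P A\<^esub> \<beta> \<longleftrightarrow> \<gamma> \<sqsubseteq>\<^bsub>fib P A\<^esub> \<alpha> \<and> \<gamma> \<sqsubseteq>\<^bsub>fib P A\<^esub> \<beta>"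
  using inf_semilattice.le_meet_iff[OF fib_inf_semilattice] assms .

lemma fib_top_closed [simp]: "A \<in> Obj C \<Longrightarrow> \<top>\<^bsub>fib P A\<^esub> \<in> carrier (fib P A)"
  using weak_partial_order_top.top_closed[OF inf_semilattice.axioms(2)[OF fib_inf_semilattice]] .

lemma fib_le_top: "\<lbrakk>A \<in> Obj C; \<alpha> \<in> carrier (fib P A)\<rbrakk> \<Longrightarrow> \<alpha> \<sqsubseteq>\<^bsub>fib P A\<^esub> \<top>\<^bsub>fib P A\<^esub>"
  using weak_partial_order_top.top_higher[OF inf_semilattice.axioms(2)[OF fib_inf_semilattice]] .

lemma rei_InfSL_hom: "f \<in> Arr C \<Longrightarrow> rei P f \<in> InfSL_hom (fib P (Cod C f)) (fib P (Dom C f))"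
  by (rule rei_hom) (simp add: Hom_iff)

lemma rei_closed [simp]:
  assumes "f \<in> Arr C" "Dom C f = A" "\<alpha> \<in> carrier (fib P (Cod C f))"
  shows "rei P f \<alpha> \<in> carrier (fib P A)"
  using rei_InfSL_hom[OF assms(1)] assms by (auto simp: InfSL_hom_def)

lemma rei_top:
  assumes "f \<in> Hom C A B"
  shows "rei P f \<top>\<^bsub>fib P B\<^esub> = \<top>\<^bsub>fib P A\<^esub>"
  using rei_hom[OF assms] by (auto simp: InfSL_hom_def)

lemma rei_meet:
  assumes "f \<in> Hom C A B" "\<alpha> \<in> carrier (fib P B)" "\<beta> \<in> carrier (fib P B)"
  shows "rei P f (\<alpha> \<sqinter>\<^bsub>fib P B\<^esub> \<beta>) = rei P f \<alpha> \<sqinter>\<^bsub>fib P A\<^esub> rei P f \<beta>"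
  using rei_hom[OF assms(1)] assms(2,3) by (auto simp: InfSL_hom_def)

lemma rei_mono:
  assumes "f \<in> Hom C A B" "\<alpha> \<in> carrier (fib P B)" "\<beta> \<in> carrier (fib P B)" "\<alpha> \<sqsubseteq>\<^bsub>fib P B\<^esub> \<beta>"
  shows "rei P f \<alpha> \<sqsubseteq>\<^bsub>fib P A\<^esub> rei P f \<beta>"
proof -
  have AB: "A \<in> Obj C" "B \<in> Obj C" and
    c: "rei P f \<alpha> \<in> carrier (fib P A)" "rei P f \<beta> \<in> carrier (fib P A)"
    using assms by (auto simp: Hom_iff)
  have "\<alpha> \<sqinter>\<^bsub>fib P B\<^esub> \<beta> = \<alpha>"
    using inf_semilattice.meet_eqI[OF fib_inf_semilattice[OF AB(2)] assms(2,3,2)]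
      fib_trans[OF _ assms(4) AB(2) _ assms(2,3)] by blast
  then have "rei P f \<alpha> = rei P f \<alpha> \<sqinter>\<^bsub>fib P A\<^esub> rei P f \<beta>"
    using rei_meet[OF assms(1-3)] by simp
  then show ?thesis
    using fib_le_meet_iff[OF AB(1) c c(1)] fib_refl[OF AB(1) c(1)] by metis
qed

lemma rei_comp:
  assumes "f \<in> Arr C" "g \<in> Arr C" "Dom C g = Cod C f" "\<alpha> \<in> carrier (fib P (Cod C g))"
  shows "rei P (g \<cdot> f) \<alpha> = rei P f (rei P g \<alpha>)"
  by (rule rei_cmp) (use assms in \<open>auto simp: Hom_iff\<close>)


section \<open>The order of the existential completion over a base arrow\<close>

text \<open>The order of the total category of the fibration associated with \<open>P\<^sup>e\<close>: it compares a pair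
  over the domain of \<open>f\<close> with a pair over its codomain. Along an identity it is the order of the
  existential completion.\<close>

definition ex_over :: "'m \<Rightarrow> 'm \<times> 'p \<Rightarrow> 'm \<times> 'p \<Rightarrow> bool" where
  "ex_over f = (\<lambda>(h, \<gamma>) (g, \<beta>).
     \<exists>w \<in> Hom C (Dom C h) (Dom C g). g \<cdot> w = f \<cdot> h \<and> \<gamma> \<sqsubseteq>\<^bsub>fib P (Dom C h)\<^esub> rei P w \<beta>)"

lemma ex_over_iff:
  "ex_over f (h, \<gamma>) (g, \<beta>) \<longleftrightarrow>
     (\<exists>w \<in> Hom C (Dom C h) (Dom C g). g \<cdot> w = f \<cdot> h \<and> \<gamma> \<sqsubseteq>\<^bsub>fib P (Dom C h)\<^esub> rei P w \<beta>)"
  by (simp add: ex_over_def)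

lemma ex_pairs_iff:
  "(g, \<alpha>) \<in> ex_pairs C P A \<longleftrightarrow>
     is_projection C g \<and> g \<in> Arr C \<and> Cod C g = A \<and> \<alpha> \<in> carrier (fib P (Dom C g))"
  by (auto simp: ex_pairs_def projection_arr)

lemma ex_pairs_obj: "x \<in> ex_pairs C P A \<Longrightarrow> A \<in> Obj C"
  by (cases x) (auto simp: ex_pairs_iff)

lemma ex_le_iff_over:
  assumes "x \<in> ex_pairs C P A"
  shows "ex_le C P x y \<longleftrightarrow> ex_over (Ide C A) x y"
  using assms by (cases x; cases y) (auto simp: ex_le_def ex_over_iff ex_pairs_iff)

lemma ex_over_refl:
  assumes "x \<in> ex_pairs C P A"
  shows "ex_over (Ide C A) x x"
proof -
  obtain g \<alpha> where x: "x = (g, \<alpha>)"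
    by (cases x)
  show ?thesis
    using assms unfolding x ex_over_iff
    by (intro bexI[of _ "Ide C (Dom C g)"]) (auto simp: ex_pairs_iff Hom_iff rei_ide intro: fib_refl)
qed

lemma ex_over_trans:
  assumes "x \<in> ex_pairs C P A" "y \<in> ex_pairs C P B" "z \<in> ex_pairs C P D"
    and "f \<in> Hom C A B" "f' \<in> Hom C B D" and xy: "ex_over f x y" and yz: "ex_over f' y z"
  shows "ex_over (f' \<cdot> f) x z"
proof -
  obtain h \<gamma> g \<beta> k \<alpha> where xyz: "x = (h, \<gamma>)" "y = (g, \<beta>)" "z = (k, \<alpha>)"
    by (cases x; cases y; cases z)
  note pairs = assms(1-5)[unfolded xyz ex_pairs_iff Hom_iff]
  obtain v where v: "v \<in> Hom C (Dom C h) (Dom C g)" "g \<cdot> v = f \<cdot> h"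
    "\<gamma> \<sqsubseteq>\<^bsub>fib P (Dom C h)\<^esub> rei P v \<beta>"
    using xy by (auto simp: xyz ex_over_iff)
  obtain w where w: "w \<in> Hom C (Dom C g) (Dom C k)" "k \<cdot> w = f' \<cdot> g"
    "\<beta> \<sqsubseteq>\<^bsub>fib P (Dom C g)\<^esub> rei P w \<alpha>"
    using yz by (auto simp: xyz ex_over_iff)
  have "k \<cdot> (w \<cdot> v) = (f' \<cdot> f) \<cdot> h"
    using v(1,2) w(1) pairs cmp_eq_extend[OF w(2), of v] by (simp add: Hom_iff)
  moreover have "\<gamma> \<sqsubseteq>\<^bsub>fib P (Dom C h)\<^esub> rei P v (rei P w \<alpha>)"
    by (rule fib_trans[OF v(3) rei_mono[OF v(1) _ _ w(3)]]) (use v(1) w(1) pairs in \<open>auto simp: Hom_iff\<close>)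
  ultimately show ?thesis
    using v(1) w(1) pairs unfolding xyz ex_over_iff
    by (intro bexI[of _ "w \<cdot> v"]) (auto simp: Hom_iff rei_comp)
qed

lemma ex_over_ide_left:
  assumes "x \<in> ex_pairs C P A" "x' \<in> ex_pairs C P A" "y \<in> ex_pairs C P B" "f \<in> Hom C A B"
    and "ex_over (Ide C A) x x'" "ex_over f x' y"
  shows "ex_over f x y"
  using ex_over_trans[OF assms(1,2,3) ide_hom assms(4-6)] assms(4)
  by (auto simp: Hom_iff)

lemma ex_over_ide_right:
  assumes "x \<in> ex_pairs C P A" "y \<in> ex_pairs C P B" "y' \<in> ex_pairs C P B" "f \<in> Hom C A B"
    and "ex_over f x y" "ex_over (Ide C B) y y'"
  shows "ex_over f x y'"
  using ex_over_trans[OF assms(1-4) ide_hom assms(5,6)] assms(4)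
  by (auto simp: Hom_iff)

lemma pullback_in_ex_pairs:
  assumes "is_pullback C f g g' f'" "f \<in> Hom C A B" "(g, \<beta>) \<in> ex_pairs C P B"
  shows "(g', rei P f' \<beta>) \<in> ex_pairs C P A"
  using pullback_legs[OF assms(1)] projection_pullback[OF assms(1)] assms(2,3)
  by (simp add: ex_pairs_iff Hom_iff)

text \<open>The pair defining \<open>P\<^sup>e\<^sub>f (g, \<beta>)\<close> is a cartesian lift of \<open>(g, \<beta>)\<close>: witnesses \<open>w\<close> into the pullback
  correspond to their components \<open>f' \<cdot> w\<close>, the other component being forced. It is stated along
  an arbitrary \<open>k\<close> so that it can be iterated in the proof of functoriality.\<close>

lemma ex_over_pullback_iff:
  assumes pb: "is_pullback C f g g' f'" and "f \<in> Hom C A B" "(g, \<beta>) \<in> ex_pairs C P B"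
    and "k \<in> Hom C D A" "z \<in> ex_pairs C P D"
  shows "ex_over k z (g', rei P f' \<beta>) \<longleftrightarrow> ex_over (f \<cdot> k) z (g, \<beta>)"
proof -
  obtain h \<gamma> where z: "z = (h, \<gamma>)"
    by (cases z)
  note legs = pullback_legs[OF pb] and pairs = assms(2-)[unfolded z ex_pairs_iff Hom_iff]
  show ?thesis
  proof
    assume "ex_over k z (g', rei P f' \<beta>)"
    then obtain w where w: "w \<in> Hom C (Dom C h) (Dom C g')" "g' \<cdot> w = k \<cdot> h"
      "\<gamma> \<sqsubseteq>\<^bsub>fib P (Dom C h)\<^esub> rei P w (rei P f' \<beta>)"
      by (auto simp: z ex_over_iff)
    have "g \<cdot> (f' \<cdot> w) = f \<cdot> (g' \<cdot> w)"
      using w(1) legs by (metis Hom_iff assoc)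
    then show "ex_over (f \<cdot> k) z (g, \<beta>)"
      using w legs pairs unfolding z ex_over_iff
      by (intro bexI[of _ "f' \<cdot> w"]) (auto simp: Hom_iff rei_comp)
  next
    assume "ex_over (f \<cdot> k) z (g, \<beta>)"
    then obtain v where v: "v \<in> Hom C (Dom C h) (Dom C g)" "g \<cdot> v = (f \<cdot> k) \<cdot> h"
      "\<gamma> \<sqsubseteq>\<^bsub>fib P (Dom C h)\<^esub> rei P v \<beta>"
      by (auto simp: z ex_over_iff)
    have kh: "k \<cdot> h \<in> Hom C (Dom C h) (Dom C f)" "f \<cdot> (k \<cdot> h) = g \<cdot> v"
      using v(2) pairs by (auto simp: Hom_iff)
    obtain w where w: "w \<in> Hom C (Dom C h) (Dom C g')" "g' \<cdot> w = k \<cdot> h" "f' \<cdot> w = v"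
      using pullback_arrow[OF pb kh(1) v(1) kh(2)] .
    then have "rei P v \<beta> = rei P w (rei P f' \<beta>)"
      using legs pairs rei_comp[of w f' \<beta>] by (simp add: Hom_iff)
    with v(3) w show "ex_over k z (g', rei P f' \<beta>)"
      unfolding z ex_over_iff by auto
  qed
qed

lemma ex_over_cmp_left_iff:
  assumes "p \<in> Arr C" "f \<in> Arr C" "Dom C f = Cod C p" "(g, \<beta>) \<in> ex_pairs C P (Dom C p)"
  shows "ex_over f (p \<cdot> g, \<beta>) y \<longleftrightarrow> ex_over (f \<cdot> p) (g, \<beta>) y"
  using assms by (cases y) (simp add: ex_over_iff ex_pairs_iff)

text \<open>The meet of \<open>(g, \<alpha>)\<close> and \<open>(h, \<beta>)\<close> lives on the fibre product of \<open>g\<close> and \<open>h\<close>, an arrow into which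
  is a pair of witnesses. Allowing an arbitrary base arrow \<open>k\<close> makes this one statement yield both
  that it is the meet and that reindexing preserves it.\<close>

lemma ex_over_meet_iff:
  assumes pb: "is_pullback C g h h' g'" and x: "(g, \<alpha>) \<in> ex_pairs C P A"
    and y: "(h, \<beta>) \<in> ex_pairs C P A" and z: "z \<in> ex_pairs C P D" and k: "k \<in> Hom C D A"
  shows "ex_over k z (g \<cdot> h', rei P h' \<alpha> \<sqinter>\<^bsub>fib P (Dom C h')\<^esub> rei P g' \<beta>) \<longleftrightarrow>
         ex_over k z (g, \<alpha>) \<and> ex_over k z (h, \<beta>)"
proof -
  obtain l \<gamma> where zl: "z = (l, \<gamma>)"
    by (cases z)
  note legs = pullback_legs[OF pb] and pairs = x y z k
  note pairs = pairs[unfolded zl ex_pairs_iff Hom_iff]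
  have split: "\<gamma> \<sqsubseteq>\<^bsub>fib P (Dom C l)\<^esub> rei P w (rei P h' \<alpha> \<sqinter>\<^bsub>fib P (Dom C h')\<^esub> rei P g' \<beta>) \<longleftrightarrow>
      \<gamma> \<sqsubseteq>\<^bsub>fib P (Dom C l)\<^esub> rei P (h' \<cdot> w) \<alpha> \<and> \<gamma> \<sqsubseteq>\<^bsub>fib P (Dom C l)\<^esub> rei P (g' \<cdot> w) \<beta>"
    if "w \<in> Hom C (Dom C l) (Dom C h')" for w
    using that legs pairs rei_meet[OF that, of "rei P h' \<alpha>" "rei P g' \<beta>"]
    by (simp add: Hom_iff rei_comp fib_le_meet_iff)
  show ?thesis
  proof (intro iffI conjI; (elim conjE)?)
    assume "ex_over k z (g \<cdot> h', rei P h' \<alpha> \<sqinter>\<^bsub>fib P (Dom C h')\<^esub> rei P g' \<beta>)"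
    then obtain w where w: "w \<in> Hom C (Dom C l) (Dom C h')" "(g \<cdot> h') \<cdot> w = k \<cdot> l"
      "\<gamma> \<sqsubseteq>\<^bsub>fib P (Dom C l)\<^esub> rei P (h' \<cdot> w) \<alpha>" "\<gamma> \<sqsubseteq>\<^bsub>fib P (Dom C l)\<^esub> rei P (g' \<cdot> w) \<beta>"
      using legs split by (auto simp: zl ex_over_iff)
    have "g \<cdot> (h' \<cdot> w) = k \<cdot> l" "h \<cdot> (g' \<cdot> w) = k \<cdot> l"
      using w(1,2) legs by (metis Hom_iff assoc)+
    with w legs have "h' \<cdot> w \<in> Hom C (Dom C l) (Dom C g)" "g' \<cdot> w \<in> Hom C (Dom C l) (Dom C h)"
      "g \<cdot> (h' \<cdot> w) = k \<cdot> l" "h \<cdot> (g' \<cdot> w) = k \<cdot> l"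
      by (auto simp: Hom_iff)
    with w(3,4) show "ex_over k z (g, \<alpha>)" "ex_over k z (h, \<beta>)"
      unfolding zl ex_over_iff by blast+
  next
    assume "ex_over k z (g, \<alpha>)" "ex_over k z (h, \<beta>)"
    then obtain u v where u: "u \<in> Hom C (Dom C l) (Dom C g)" "g \<cdot> u = k \<cdot> l"
        "\<gamma> \<sqsubseteq>\<^bsub>fib P (Dom C l)\<^esub> rei P u \<alpha>"
      and v: "v \<in> Hom C (Dom C l) (Dom C h)" "h \<cdot> v = k \<cdot> l" "\<gamma> \<sqsubseteq>\<^bsub>fib P (Dom C l)\<^esub> rei P v \<beta>"
      by (auto simp: zl ex_over_iff)
    obtain w where w: "w \<in> Hom C (Dom C l) (Dom C h')" "h' \<cdot> w = u" "g' \<cdot> w = v"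
      using pullback_arrow[OF pb u(1) v(1)] u(2) v(2) by metis
    then show "ex_over k z (g \<cdot> h', rei P h' \<alpha> \<sqinter>\<^bsub>fib P (Dom C h')\<^esub> rei P g' \<beta>)"
      using legs u v split[OF w(1)] unfolding zl ex_over_iff
      by (intro bexI[of _ w]) (auto simp: Hom_iff)
  qed
qed

lemma meet_in_ex_pairs:
  assumes "is_pullback C g h h' g'" "(g, \<alpha>) \<in> ex_pairs C P A" "(h, \<beta>) \<in> ex_pairs C P A"
  shows "(g \<cdot> h', rei P h' \<alpha> \<sqinter>\<^bsub>fib P (Dom C h')\<^esub> rei P g' \<beta>) \<in> ex_pairs C P A"
  using assms(2,3) pullback_legs[OF assms(1)] projection_pullback[OF assms(1)] projection_cmp[of g h']
  by (simp add: ex_pairs_iff)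

end


section \<open>The existential completion is a primary doctrine\<close>

context primary_doctrine
begin

definition ex_class :: "'o \<Rightarrow> 'm \<times> 'p \<Rightarrow> ('m \<times> 'p) set" where
  "ex_class A x = ex_equiv C P A `` {x}"

lemma ex_le_trans:
  assumes "x \<in> ex_pairs C P A" "y \<in> ex_pairs C P A" "z \<in> ex_pairs C P A"
    and "ex_le C P x y" "ex_le C P y z"
  shows "ex_le C P x z"
proof -
  have "Ide C A \<in> Hom C A A"
    using ex_pairs_obj[OF assms(1)] by (rule ide_hom)
  from ex_over_ide_left[OF assms(1-3) this] show ?thesis
    using assms by (simp add: ex_le_iff_over)
qed

lemma ex_le_refl: "x \<in> ex_pairs C P A \<Longrightarrow> ex_le C P x x"
  by (simp add: ex_le_iff_over ex_over_refl)

lemma equiv_ex_equiv: "equiv (ex_pairs C P A) (ex_equiv C P A)"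
proof (rule equivI)
  show "refl_on (ex_pairs C P A) (ex_equiv C P A)"
    by (auto simp: refl_on_def ex_equiv_def intro: ex_le_refl)
  show "sym (ex_equiv C P A)"
    by (auto simp: sym_def ex_equiv_def)
  show "trans (ex_equiv C P A)"
    unfolding trans_def ex_equiv_def using ex_le_trans by blast
  show "ex_equiv C P A \<subseteq> ex_pairs C P A \<times> ex_pairs C P A"
    by (auto simp: ex_equiv_def)
qed

lemma in_ex_class_iff:
  "x \<in> ex_pairs C P A \<Longrightarrow>
     y \<in> ex_class A x \<longleftrightarrow> y \<in> ex_pairs C P A \<and> ex_le C P x y \<and> ex_le C P y x"
  by (auto simp: ex_class_def ex_equiv_def)

lemma ex_class_eq_iff:
  "\<lbrakk>x \<in> ex_pairs C P A; y \<in> ex_pairs C P A\<rbrakk> \<Longrightarrow>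
     ex_class A x = ex_class A y \<longleftrightarrow> ex_le C P x y \<and> ex_le C P y x"
  unfolding ex_class_def by (subst eq_equiv_class_iff[OF equiv_ex_equiv]) (auto simp: ex_equiv_def)

lemma ex_class_in_carrier [simp]:
  "x \<in> ex_pairs C P A \<Longrightarrow> ex_class A x \<in> carrier (ex_fib C P A)"
  by (auto simp: ex_fib_def ex_class_def intro: quotientI)

lemma ex_carrierE:
  assumes "K \<in> carrier (ex_fib C P A)"
  obtains x where "x \<in> ex_pairs C P A" "K = ex_class A x"
  using assms that by (auto simp: ex_fib_def ex_class_def elim: quotientE)

lemma ex_fib_le_iff:
  assumes x: "x \<in> ex_pairs C P A" and y: "y \<in> ex_pairs C P A"
  shows "ex_class A x \<sqsubseteq>\<^bsub>ex_fib C P A\<^esub> ex_class A y \<longleftrightarrow> ex_le C P x y"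
proof
  assume "ex_class A x \<sqsubseteq>\<^bsub>ex_fib C P A\<^esub> ex_class A y"
  then obtain x' y' where "x' \<in> ex_pairs C P A" "ex_le C P x x'" "y' \<in> ex_pairs C P A"
      "ex_le C P y' y" "ex_le C P x' y'"
    using x y by (auto simp: ex_fib_def in_ex_class_iff)
  then show "ex_le C P x y"
    using x y ex_le_trans by metis
next
  assume "ex_le C P x y"
  moreover have "x \<in> ex_class A x" "y \<in> ex_class A y"
    using x y by (simp_all add: in_ex_class_iff ex_le_refl)
  ultimately show "ex_class A x \<sqsubseteq>\<^bsub>ex_fib C P A\<^esub> ex_class A y"
    by (auto simp: ex_fib_def)
qed

lemma ex_fib_partial_order: "partial_order (ex_fib C P A)"
proof
  show "(.=\<^bsub>ex_fib C P A\<^esub>) = (=)"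
    by (simp add: ex_fib_def)
next
  fix K
  assume "K \<in> carrier (ex_fib C P A)"
  then show "K \<sqsubseteq>\<^bsub>ex_fib C P A\<^esub> K"
    by (elim ex_carrierE) (simp add: ex_fib_le_iff ex_le_refl)
next
  fix K L
  assume le: "K \<sqsubseteq>\<^bsub>ex_fib C P A\<^esub> L" "L \<sqsubseteq>\<^bsub>ex_fib C P A\<^esub> K"
    and KL: "K \<in> carrier (ex_fib C P A)" "L \<in> carrier (ex_fib C P A)"
  from KL obtain x y where "x \<in> ex_pairs C P A" "K = ex_class A x"
      "y \<in> ex_pairs C P A" "L = ex_class A y"
    by (elim ex_carrierE)
  with le have "K = L"
    by (simp add: ex_fib_le_iff ex_class_eq_iff)
  then show "K .=\<^bsub>ex_fib C P A\<^esub> L"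
    by (simp add: ex_fib_def)
next
  fix K L M
  assume le: "K \<sqsubseteq>\<^bsub>ex_fib C P A\<^esub> L" "L \<sqsubseteq>\<^bsub>ex_fib C P A\<^esub> M"
    and KLM: "K \<in> carrier (ex_fib C P A)" "L \<in> carrier (ex_fib C P A)"
      "M \<in> carrier (ex_fib C P A)"
  from KLM obtain x y z where xyz: "x \<in> ex_pairs C P A" "K = ex_class A x"
      "y \<in> ex_pairs C P A" "L = ex_class A y" "z \<in> ex_pairs C P A" "M = ex_class A z"
    by (elim ex_carrierE)
  with le show "K \<sqsubseteq>\<^bsub>ex_fib C P A\<^esub> M"
    using ex_le_trans[of x A y z] by (simp add: ex_fib_le_iff)
qed (auto simp: ex_fib_def)

text \<open>The Yoneda lemma for the fibre over \<open>A\<close>.\<close>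

lemma ex_class_eqI:
  assumes "x \<in> ex_pairs C P A" "y \<in> ex_pairs C P A"
    and "\<And>z. z \<in> ex_pairs C P A \<Longrightarrow> ex_over (Ide C A) z x \<longleftrightarrow> ex_over (Ide C A) z y"
  shows "ex_class A x = ex_class A y"
  using assms(1,2) assms(3)[OF assms(1)] assms(3)[OF assms(2)]
  by (simp add: ex_class_eq_iff ex_le_iff_over ex_over_refl)

text \<open>All representatives and all pullbacks give the same class, since by the cartesian property the
  elements below \<open>(h', P\<^sub>k\<^sub>' \<gamma>)\<close> are those below \<open>(h, \<gamma>)\<close> along \<open>f\<close>, a condition that only depends on
  the class of \<open>(h, \<gamma>)\<close>.\<close>

lemma ex_rei_class:
  assumes pb: "is_pullback C f g g' f'" and f: "f \<in> Hom C A B" and y: "(g, \<beta>) \<in> ex_pairs C P B"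
  shows "ex_rei C P f (ex_class B (g, \<beta>)) = ex_class A (g', rei P f' \<beta>)"
proof -
  have obj: "A \<in> Obj C" "Ide C A \<in> Hom C A A"
    using f by (auto simp: Hom_iff)
  have indep: "ex_class A (h', rei P k' \<gamma>) = ex_class A (g', rei P f' \<beta>)"
    if h: "(h, \<gamma>) \<in> ex_class B (g, \<beta>)" and hpb: "is_pullback C f h h' k'" for h \<gamma> h' k'
  proof -
    have z: "(h, \<gamma>) \<in> ex_pairs C P B" and le: "ex_over (Ide C B) (h, \<gamma>) (g, \<beta>)"
      "ex_over (Ide C B) (g, \<beta>) (h, \<gamma>)"
      using h y by (auto simp: in_ex_class_iff ex_le_iff_over)
    show ?thesis
    proof (rule ex_class_eqI)
      show "(h', rei P k' \<gamma>) \<in> ex_pairs C P A" "(g', rei P f' \<beta>) \<in> ex_pairs C P A"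
        using pullback_in_ex_pairs[OF hpb f z] pullback_in_ex_pairs[OF pb f y] .
    next
      fix x
      assume x: "x \<in> ex_pairs C P A"
      have "ex_over f x (h, \<gamma>) \<longleftrightarrow> ex_over f x (g, \<beta>)"
        using ex_over_ide_right[OF x z y f _ le(1)] ex_over_ide_right[OF x y z f _ le(2)] by blast
      then show "ex_over (Ide C A) x (h', rei P k' \<gamma>) \<longleftrightarrow> ex_over (Ide C A) x (g', rei P f' \<beta>)"
        using ex_over_pullback_iff[OF hpb f z obj(2) x] ex_over_pullback_iff[OF pb f y obj(2) x] f
        by (simp add: Hom_iff)
    qed
  qed
  have "(g, \<beta>) \<in> ex_class B (g, \<beta>)"
    using y by (simp add: in_ex_class_iff ex_le_refl)
  moreover have "ex_rei C P f (ex_class B (g, \<beta>)) =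
      (\<Union>(h, \<gamma>) \<in> ex_class B (g, \<beta>). \<Union>(h', k') \<in> {(h', k'). is_pullback C f h h' k'}.
         ex_class A (h', rei P k' \<gamma>))"
    using f by (simp add: ex_rei_def ex_class_def Hom_iff)
  ultimately show ?thesis
    using indep pb by fast
qed

text \<open>The interface through which reindexing is used below: it hides the choice of a pullback and keeps
  only the cartesian property.\<close>

lemma ex_reiE:
  assumes f: "f \<in> Hom C A B" and y: "y \<in> ex_pairs C P B"
  obtains x where "x \<in> ex_pairs C P A" "ex_rei C P f (ex_class B y) = ex_class A x"
    "\<And>D k z. \<lbrakk>k \<in> Hom C D A; z \<in> ex_pairs C P D\<rbrakk> \<Longrightarrow> ex_over k z x \<longleftrightarrow> ex_over (f \<cdot> k) z y"
proof -
  obtain g \<beta> where yg: "y = (g, \<beta>)"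
    by (cases y)
  note y' = y[unfolded yg]
  obtain g' f' where pb: "is_pullback C f g g' f'"
    using projection_pullback_exists[of g f A] f y' by (auto simp: ex_pairs_iff Hom_iff)
  show ?thesis
    using that[OF pullback_in_ex_pairs[OF pb f y']] ex_rei_class[OF pb f y']
      ex_over_pullback_iff[OF pb f y'] unfolding yg by blast
qed

lemma ex_le_rei_iff:
  assumes f: "f \<in> Hom C A B" and z: "z \<in> ex_pairs C P A" and y: "y \<in> ex_pairs C P B"
  shows "ex_class A z \<sqsubseteq>\<^bsub>ex_fib C P A\<^esub> ex_rei C P f (ex_class B y) \<longleftrightarrow> ex_over f z y"
proof -
  obtain x where x: "x \<in> ex_pairs C P A" "ex_rei C P f (ex_class B y) = ex_class A x"
    "ex_over (Ide C A) z x \<longleftrightarrow> ex_over (f \<cdot> Ide C A) z y"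
    using ex_reiE[OF f y] ide_hom[OF ex_pairs_obj[OF z]] z by metis
  then show ?thesis
    using f z by (simp add: ex_fib_le_iff ex_le_iff_over Hom_iff)
qed

lemma ex_rei_closed:
  assumes "f \<in> Hom C A B" "K \<in> carrier (ex_fib C P B)"
  shows "ex_rei C P f K \<in> carrier (ex_fib C P A)"
proof -
  obtain y where y: "y \<in> ex_pairs C P B" "K = ex_class B y"
    using assms(2) by (rule ex_carrierE)
  show ?thesis
    using ex_reiE[OF assms(1) y(1)] y(2) by (metis ex_class_in_carrier)
qed

lemma ex_rei_ide:
  assumes "K \<in> carrier (ex_fib C P A)"
  shows "ex_rei C P (Ide C A) K = K"
proof -
  obtain y where y: "y \<in> ex_pairs C P A" "K = ex_class A y"
    using assms by (rule ex_carrierE)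
  note id = ide_hom[OF ex_pairs_obj[OF y(1)]]
  obtain x where x: "x \<in> ex_pairs C P A" "ex_rei C P (Ide C A) (ex_class A y) = ex_class A x"
    "\<And>z. z \<in> ex_pairs C P A \<Longrightarrow> ex_over (Ide C A) z x \<longleftrightarrow> ex_over (Ide C A \<cdot> Ide C A) z y"
    using ex_reiE[OF id y(1)] id by metis
  have "ex_class A x = ex_class A y"
    using x(3) id by (intro ex_class_eqI x(1) y(1)) (simp add: Hom_iff)
  with x(2) y(2) show ?thesis
    by simp
qed

lemma ex_rei_cmp:
  assumes f: "f \<in> Hom C A B" and g: "g \<in> Hom C B D" and K: "K \<in> carrier (ex_fib C P D)"
  shows "ex_rei C P (g \<cdot> f) K = ex_rei C P f (ex_rei C P g K)"
proof -
  obtain y where y: "y \<in> ex_pairs C P D" "K = ex_class D y"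
    using K by (rule ex_carrierE)
  have id: "Ide C A \<in> Hom C A A" "f \<cdot> Ide C A \<in> Hom C A B" "(g \<cdot> f) \<cdot> Ide C A = g \<cdot> (f \<cdot> Ide C A)"
    using f g by (auto simp: Hom_iff)
  obtain x where x: "x \<in> ex_pairs C P B" "ex_rei C P g (ex_class D y) = ex_class B x"
    "\<And>k z. \<lbrakk>k \<in> Hom C A B; z \<in> ex_pairs C P A\<rbrakk> \<Longrightarrow> ex_over k z x \<longleftrightarrow> ex_over (g \<cdot> k) z y"
    using ex_reiE[OF g y(1)] by metis
  obtain u where u: "u \<in> ex_pairs C P A" "ex_rei C P f (ex_class B x) = ex_class A u"
    "\<And>z. z \<in> ex_pairs C P A \<Longrightarrow> ex_over (Ide C A) z u \<longleftrightarrow> ex_over (f \<cdot> Ide C A) z x"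
    using ex_reiE[OF f x(1)] id(1) by metis
  obtain v where v: "v \<in> ex_pairs C P A" "ex_rei C P (g \<cdot> f) (ex_class D y) = ex_class A v"
    "\<And>z. z \<in> ex_pairs C P A \<Longrightarrow> ex_over (Ide C A) z v \<longleftrightarrow> ex_over ((g \<cdot> f) \<cdot> Ide C A) z y"
    using ex_reiE[OF cmp_hom[OF f g] y(1)] id(1) by metis
  have "ex_class A v = ex_class A u"
    by (rule ex_class_eqI[OF v(1) u(1)]) (simp only: u(3) v(3) x(3) id)
  then show ?thesis
    using u(2) v(2) x(2) y(2) by simp
qed

text \<open>The corresponding interface for binary meets, hiding the choice of the fibre product.\<close>

lemma ex_meetE:
  assumes x: "x \<in> ex_pairs C P A" and y: "y \<in> ex_pairs C P A"
  obtains m where "m \<in> ex_pairs C P A"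
    "\<And>D k z. \<lbrakk>k \<in> Hom C D A; z \<in> ex_pairs C P D\<rbrakk> \<Longrightarrow>
       ex_over k z m \<longleftrightarrow> ex_over k z x \<and> ex_over k z y"
proof -
  obtain g \<alpha> h \<beta> where xy: "x = (g, \<alpha>)" "y = (h, \<beta>)"
    by (cases x; cases y)
  obtain h' g' where pb: "is_pullback C g h h' g'"
    using projection_pullback_exists[of h g "Dom C g"] x y
    by (auto simp: xy ex_pairs_iff Hom_iff)
  show ?thesis
    using that[OF meet_in_ex_pairs[OF pb x[unfolded xy] y[unfolded xy]]]
      ex_over_meet_iff[OF pb x[unfolded xy] y[unfolded xy]] unfolding xy by blast
qed

lemma ex_over_top:
  assumes "f \<in> Hom C A B" "z \<in> ex_pairs C P A"
  shows "ex_over f z (Ide C B, \<top>\<^bsub>fib P B\<^esub>)"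
proof -
  obtain h \<gamma> where z: "z = (h, \<gamma>)"
    by (cases z)
  have fh: "f \<cdot> h \<in> Hom C (Dom C h) B"
    using assms by (auto simp: z ex_pairs_iff Hom_iff)
  show ?thesis
    using assms fh rei_top[OF fh] unfolding z ex_over_iff
    by (intro bexI[of _ "f \<cdot> h"]) (auto simp: ex_pairs_iff Hom_iff intro: fib_le_top)
qed

lemma ex_top_in_ex_pairs: "A \<in> Obj C \<Longrightarrow> (Ide C A, \<top>\<^bsub>fib P A\<^esub>) \<in> ex_pairs C P A"
  by (simp add: ex_pairs_iff projection_ide)

lemma ex_fib_inf_semilattice:
  assumes "A \<in> Obj C"
  shows "inf_semilattice (ex_fib C P A)"
proof (rule inf_semilatticeI[OF ex_fib_partial_order])
  have "K \<sqsubseteq>\<^bsub>ex_fib C P A\<^esub> ex_class A (Ide C A, \<top>\<^bsub>fib P A\<^esub>)" if "K \<in> carrier (ex_fib C P A)" for K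
    using that ex_over_top[OF ide_hom[OF assms]] ex_top_in_ex_pairs[OF assms]
    by (elim ex_carrierE) (simp add: ex_fib_le_iff ex_le_iff_over)
  then show "\<exists>T \<in> carrier (ex_fib C P A). \<forall>K \<in> carrier (ex_fib C P A). K \<sqsubseteq>\<^bsub>ex_fib C P A\<^esub> T"
    using ex_class_in_carrier[OF ex_top_in_ex_pairs[OF assms]] by blast
next
  fix K L
  assume "K \<in> carrier (ex_fib C P A)" "L \<in> carrier (ex_fib C P A)"
  then obtain x y where xy: "x \<in> ex_pairs C P A" "K = ex_class A x"
      "y \<in> ex_pairs C P A" "L = ex_class A y"
    by (elim ex_carrierE)
  obtain m where m: "m \<in> ex_pairs C P A"
    "\<And>z. z \<in> ex_pairs C P A \<Longrightarrow>
       ex_over (Ide C A) z m \<longleftrightarrow> ex_over (Ide C A) z x \<and> ex_over (Ide C A) z y"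
    using ex_meetE[OF xy(1,3)] ide_hom[OF assms] by metis
  have "N \<sqsubseteq>\<^bsub>ex_fib C P A\<^esub> ex_class A m \<longleftrightarrow> N \<sqsubseteq>\<^bsub>ex_fib C P A\<^esub> K \<and> N \<sqsubseteq>\<^bsub>ex_fib C P A\<^esub> L"
    if "N \<in> carrier (ex_fib C P A)" for N
    using that xy m by (elim ex_carrierE) (simp add: ex_fib_le_iff ex_le_iff_over)
  then show "\<exists>M \<in> carrier (ex_fib C P A). \<forall>N \<in> carrier (ex_fib C P A).
      N \<sqsubseteq>\<^bsub>ex_fib C P A\<^esub> M \<longleftrightarrow> N \<sqsubseteq>\<^bsub>ex_fib C P A\<^esub> K \<and> N \<sqsubseteq>\<^bsub>ex_fib C P A\<^esub> L"
    using ex_class_in_carrier[OF m(1)] by blast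
qed

lemma ex_meet_eqI:
  assumes "x \<in> ex_pairs C P A" "y \<in> ex_pairs C P A" "m \<in> ex_pairs C P A"
    and "\<And>z. z \<in> ex_pairs C P A \<Longrightarrow>
       ex_over (Ide C A) z m \<longleftrightarrow> ex_over (Ide C A) z x \<and> ex_over (Ide C A) z y"
  shows "ex_class A x \<sqinter>\<^bsub>ex_fib C P A\<^esub> ex_class A y = ex_class A m"
proof (rule inf_semilattice.meet_eqI[OF ex_fib_inf_semilattice])
  show "A \<in> Obj C"
    using assms(1) by (rule ex_pairs_obj)
  fix N
  assume "N \<in> carrier (ex_fib C P A)"
  then show "N \<sqsubseteq>\<^bsub>ex_fib C P A\<^esub> ex_class A m \<longleftrightarrow>
      N \<sqsubseteq>\<^bsub>ex_fib C P A\<^esub> ex_class A x \<and> N \<sqsubseteq>\<^bsub>ex_fib C P A\<^esub> ex_class A y"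
    using assms by (elim ex_carrierE) (simp add: ex_fib_le_iff ex_le_iff_over)
qed (use assms in auto)

lemma ex_meet_class:
  assumes "is_pullback C g h h' g'" "(g, \<alpha>) \<in> ex_pairs C P A" "(h, \<beta>) \<in> ex_pairs C P A"
  shows "ex_class A (g, \<alpha>) \<sqinter>\<^bsub>ex_fib C P A\<^esub> ex_class A (h, \<beta>) =
         ex_class A (g \<cdot> h', rei P h' \<alpha> \<sqinter>\<^bsub>fib P (Dom C h')\<^esub> rei P g' \<beta>)"
  by (rule ex_meet_eqI[OF assms(2,3) meet_in_ex_pairs[OF assms]])
    (rule ex_over_meet_iff[OF assms _ ide_hom[OF ex_pairs_obj[OF assms(2)]]])

lemma ex_top_class:
  assumes "A \<in> Obj C"
  shows "\<top>\<^bsub>ex_fib C P A\<^esub> = ex_class A (Ide C A, \<top>\<^bsub>fib P A\<^esub>)"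
proof -
  interpret F: inf_semilattice "ex_fib C P A"
    using assms by (rule ex_fib_inf_semilattice)
  obtain t where t: "t \<in> ex_pairs C P A" "\<top>\<^bsub>ex_fib C P A\<^esub> = ex_class A t"
    using F.top_closed by (rule ex_carrierE)
  have "ex_le C P t (Ide C A, \<top>\<^bsub>fib P A\<^esub>)"
    using t(1) ex_over_top[OF ide_hom[OF assms] t(1)] by (simp add: ex_le_iff_over)
  moreover have "ex_le C P (Ide C A, \<top>\<^bsub>fib P A\<^esub>) t"
    using F.top_higher[OF ex_class_in_carrier[OF ex_top_in_ex_pairs[OF assms]]] t
      ex_fib_le_iff[OF ex_top_in_ex_pairs[OF assms] t(1)] by simp
  ultimately show ?thesis
    using t ex_top_in_ex_pairs[OF assms] by (simp add: ex_class_eq_iff)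
qed

lemma ex_rei_top:
  assumes f: "f \<in> Hom C A B"
  shows "ex_rei C P f \<top>\<^bsub>ex_fib C P B\<^esub> = \<top>\<^bsub>ex_fib C P A\<^esub>"
proof -
  have obj: "A \<in> Obj C" "B \<in> Obj C"
    using f by (auto simp: Hom_iff)
  obtain x where x: "x \<in> ex_pairs C P A"
    "ex_rei C P f (ex_class B (Ide C B, \<top>\<^bsub>fib P B\<^esub>)) = ex_class A x"
    "\<And>z. z \<in> ex_pairs C P A \<Longrightarrow>
       ex_over (Ide C A) z x \<longleftrightarrow> ex_over (f \<cdot> Ide C A) z (Ide C B, \<top>\<^bsub>fib P B\<^esub>)"
    using ex_reiE[OF f ex_top_in_ex_pairs[OF obj(2)]] ide_hom[OF obj(1)] by metis
  have "ex_class A x = ex_class A (Ide C A, \<top>\<^bsub>fib P A\<^esub>)"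
    using f x(3) ex_over_top[OF f] ex_over_top[OF ide_hom[OF obj(1)]]
    by (intro ex_class_eqI x(1) ex_top_in_ex_pairs obj) (simp add: Hom_iff)
  then show ?thesis
    using x(2) obj by (simp add: ex_top_class)
qed

lemma ex_rei_meet:
  assumes f: "f \<in> Hom C A B" and K: "K \<in> carrier (ex_fib C P B)" and L: "L \<in> carrier (ex_fib C P B)"
  shows "ex_rei C P f (K \<sqinter>\<^bsub>ex_fib C P B\<^esub> L) =
         ex_rei C P f K \<sqinter>\<^bsub>ex_fib C P A\<^esub> ex_rei C P f L"
proof -
  have id: "Ide C A \<in> Hom C A A" "Ide C B \<in> Hom C B B" "f \<cdot> Ide C A \<in> Hom C A B"
    using f by (auto simp: Hom_iff)
  obtain x y where xy: "x \<in> ex_pairs C P B" "K = ex_class B x" "y \<in> ex_pairs C P B" "L = ex_class B y"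
    using K L by (elim ex_carrierE)
  obtain m where m: "m \<in> ex_pairs C P B"
    "\<And>D k z. \<lbrakk>k \<in> Hom C D B; z \<in> ex_pairs C P D\<rbrakk> \<Longrightarrow>
       ex_over k z m \<longleftrightarrow> ex_over k z x \<and> ex_over k z y"
    using ex_meetE[OF xy(1,3)] by blast
  obtain x' where x': "x' \<in> ex_pairs C P A" "ex_rei C P f (ex_class B x) = ex_class A x'"
    "\<And>z. z \<in> ex_pairs C P A \<Longrightarrow> ex_over (Ide C A) z x' \<longleftrightarrow> ex_over (f \<cdot> Ide C A) z x"
    using ex_reiE[OF f xy(1)] id(1) by metis
  obtain y' where y': "y' \<in> ex_pairs C P A" "ex_rei C P f (ex_class B y) = ex_class A y'"
    "\<And>z. z \<in> ex_pairs C P A \<Longrightarrow> ex_over (Ide C A) z y' \<longleftrightarrow> ex_over (f \<cdot> Ide C A) z y"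
    using ex_reiE[OF f xy(3)] id(1) by metis
  obtain m' where m': "m' \<in> ex_pairs C P A" "ex_rei C P f (ex_class B m) = ex_class A m'"
    "\<And>z. z \<in> ex_pairs C P A \<Longrightarrow> ex_over (Ide C A) z m' \<longleftrightarrow> ex_over (f \<cdot> Ide C A) z m"
    using ex_reiE[OF f m(1)] id(1) by metis
  have "ex_class B x \<sqinter>\<^bsub>ex_fib C P B\<^esub> ex_class B y = ex_class B m"
    by (rule ex_meet_eqI[OF xy(1,3) m(1)]) (rule m(2)[OF id(2)])
  moreover have "ex_class A x' \<sqinter>\<^bsub>ex_fib C P A\<^esub> ex_class A y' = ex_class A m'"
    by (rule ex_meet_eqI[OF x'(1) y'(1) m'(1)]) (simp only: x'(3) y'(3) m'(3) m(2)[OF id(3)])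
  ultimately show ?thesis
    using xy x'(2) y'(2) m'(2) by simp
qed

lemma existential_completion_simps [simp]:
  "fib (existential_completion C P) = ex_fib C P"
  "rei (existential_completion C P) = ex_rei C P"
  by (simp_all add: existential_completion_def)

theorem primary_doctrine_existential_completion:
  "primary_doctrine C (existential_completion C P)"
  by (intro primary_doctrine.intro primary_doctrine_axioms.intro category_with_finite_products_axioms)
    (auto simp: InfSL_hom_def ex_fib_inf_semilattice ex_rei_closed ex_rei_top ex_rei_meet
      ex_rei_ide ex_rei_cmp)

end


section \<open>The existential completion is existential\<close>

context primary_doctrine
begin

text \<open>Existential quantification along \<open>p\<close>. As for \<open>ex_rei\<close>, the union ranges over classes that all
  coincide.\<close>

definition ex_image :: "'m \<Rightarrow> ('m \<times> 'p) set \<Rightarrow> ('m \<times> 'p) set" where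
  "ex_image p K = (\<Union>(g, \<beta>) \<in> K. ex_class (Cod C p) (p \<cdot> g, \<beta>))"

lemma cmp_in_ex_pairs:
  assumes "is_projection C p" "(g, \<beta>) \<in> ex_pairs C P (Dom C p)"
  shows "(p \<cdot> g, \<beta>) \<in> ex_pairs C P (Cod C p)"
  using assms projection_cmp[of p g] projection_arr[of p] by (simp add: ex_pairs_iff)

text \<open>The adjunction between composition with \<open>p\<close> and reindexing along \<open>p\<close>, at the level of pairs: both
  sides ask for \<open>w\<close> with the same two properties, by associativity.\<close>

lemma ex_le_cmp_iff:
  assumes "is_projection C p" "(g, \<beta>) \<in> ex_pairs C P (Dom C p)"
  shows "ex_le C P (p \<cdot> g, \<beta>) y \<longleftrightarrow> ex_over p (g, \<beta>) y"
proof -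
  have p: "p \<in> Arr C" "Ide C (Cod C p) \<in> Arr C" "Dom C (Ide C (Cod C p)) = Cod C p"
    using projection_arr[OF assms(1)] by auto
  show ?thesis
    unfolding ex_le_iff_over[OF cmp_in_ex_pairs[OF assms]]
    using ex_over_cmp_left_iff[OF p assms(2)] p by simp
qed

lemma ex_image_class:
  assumes p: "is_projection C p" and x: "(g, \<beta>) \<in> ex_pairs C P (Dom C p)"
  shows "ex_image p (ex_class (Dom C p) (g, \<beta>)) = ex_class (Cod C p) (p \<cdot> g, \<beta>)"
proof -
  have pH: "p \<in> Hom C (Dom C p) (Cod C p)"
    using projection_arr[OF p] by (simp add: Hom_iff)
  have mono: "ex_le C P (p \<cdot> g1, \<beta>1) (p \<cdot> g2, \<beta>2)"
    if x1: "(g1, \<beta>1) \<in> ex_pairs C P (Dom C p)" and x2: "(g2, \<beta>2) \<in> ex_pairs C P (Dom C p)"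
      and le: "ex_le C P (g1, \<beta>1) (g2, \<beta>2)" for g1 \<beta>1 g2 \<beta>2
  proof -
    have "ex_over p (g2, \<beta>2) (p \<cdot> g2, \<beta>2)"
      using ex_le_cmp_iff[OF p x2] ex_le_refl[OF cmp_in_ex_pairs[OF p x2]] by blast
    then show ?thesis
      using ex_over_ide_left[OF x1 x2 cmp_in_ex_pairs[OF p x2] pH] le
      by (simp add: ex_le_cmp_iff[OF p x1] ex_le_iff_over[OF x1])
  qed
  have "ex_class (Cod C p) (p \<cdot> h, \<gamma>) = ex_class (Cod C p) (p \<cdot> g, \<beta>)"
    if "(h, \<gamma>) \<in> ex_class (Dom C p) (g, \<beta>)" for h \<gamma>
    using that x mono cmp_in_ex_pairs[OF p] by (simp add: in_ex_class_iff ex_class_eq_iff)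
  moreover have "(g, \<beta>) \<in> ex_class (Dom C p) (g, \<beta>)"
    using x by (simp add: in_ex_class_iff ex_le_refl)
  ultimately show ?thesis
    unfolding ex_image_def by fast
qed

lemma ex_image_left_adjoint:
  assumes p: "is_projection C p"
  shows "left_adjoint (ex_fib C P (Dom C p)) (ex_fib C P (Cod C p)) (ex_image p) (ex_rei C P p)"
proof (rule left_adjointI[OF ex_fib_partial_order ex_fib_partial_order])
  have pH: "p \<in> Hom C (Dom C p) (Cod C p)"
    using projection_arr[OF p] by (simp add: Hom_iff)
  show "ex_rei C P p L \<in> carrier (ex_fib C P (Dom C p))"
    if "L \<in> carrier (ex_fib C P (Cod C p))" for L
    using ex_rei_closed[OF pH that] .
  fix K
  assume "K \<in> carrier (ex_fib C P (Dom C p))"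
  then obtain g \<beta> where x: "(g, \<beta>) \<in> ex_pairs C P (Dom C p)" "K = ex_class (Dom C p) (g, \<beta>)"
    by (elim ex_carrierE) auto
  show "ex_image p K \<in> carrier (ex_fib C P (Cod C p))"
    using x cmp_in_ex_pairs[OF p x(1)] by (simp add: ex_image_class[OF p])
  fix L
  assume "L \<in> carrier (ex_fib C P (Cod C p))"
  then obtain y where y: "y \<in> ex_pairs C P (Cod C p)" "L = ex_class (Cod C p) y"
    by (elim ex_carrierE)
  show "ex_image p K \<sqsubseteq>\<^bsub>ex_fib C P (Cod C p)\<^esub> L \<longleftrightarrow> K \<sqsubseteq>\<^bsub>ex_fib C P (Dom C p)\<^esub> ex_rei C P p L"
    using x y cmp_in_ex_pairs[OF p x(1)]
    by (simp add: ex_image_class[OF p] ex_fib_le_iff ex_le_cmp_iff[OF p] ex_le_rei_iff[OF pH])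
qed

text \<open>Let \<open>g'\<close> be the pullback of \<open>g\<close> along \<open>f'\<close>. Stacking its square on the given one shows that
  \<open>p' \<cdot> g'\<close> is the pullback of \<open>p \<cdot> g\<close> along \<open>f\<close>, with the same arrow \<open>k\<close> into the domain of \<open>g\<close>;
  so both sides are the class of \<open>(p' \<cdot> g', P\<^sub>k \<beta>)\<close>.\<close>

lemma ex_image_Beck_Chevalley:
  assumes pb: "is_pullback C f p p' f'" and p: "is_projection C p" and p': "is_projection C p'"
    and K: "K \<in> carrier (ex_fib C P (Dom C p))"
  shows "ex_image p' (ex_rei C P f' K) = ex_rei C P f (ex_image p K)"
proof -
  note legs = pullback_legs[OF pb]
  obtain g \<beta> where x: "(g, \<beta>) \<in> ex_pairs C P (Dom C p)" "K = ex_class (Dom C p) (g, \<beta>)"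
    using K by (elim ex_carrierE) auto
  have f': "f' \<in> Hom C (Dom C p') (Dom C p)" and f: "f \<in> Hom C (Cod C p') (Cod C p)"
    using legs by (auto simp: Hom_iff)
  obtain g' k where gpb: "is_pullback C f' g g' k"
    using projection_pullback_exists[of g f' "Dom C p'"] x(1) legs by (auto simp: ex_pairs_iff Hom_iff)
  have "is_pullback C (p \<cdot> g) f k (p' \<cdot> g')"
    using pullback_pasting[OF is_pullback_sym[OF pb] is_pullback_sym[OF gpb]] .
  then have pg: "is_pullback C f (p \<cdot> g) (p' \<cdot> g') k"
    by (rule is_pullback_sym)
  show ?thesis
    using ex_rei_class[OF gpb f' x(1)] ex_image_class[OF p' pullback_in_ex_pairs[OF gpb f' x(1)]]
      ex_image_class[OF p x(1)] ex_rei_class[OF pg f cmp_in_ex_pairs[OF p x(1)]] x(2)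
    by simp
qed

text \<open>With \<open>K\<close> represented by \<open>h\<close> and \<open>L\<close> by \<open>g\<close>, both sides live on the fibre product of \<open>p \<cdot> g\<close> and
  \<open>h\<close>, which by pasting is also that of \<open>g\<close> and the pullback of \<open>h\<close> along \<open>p\<close>.\<close>

lemma ex_image_Frobenius:
  assumes p: "is_projection C p"
    and K: "K \<in> carrier (ex_fib C P (Cod C p))" and L: "L \<in> carrier (ex_fib C P (Dom C p))"
  shows "ex_image p (ex_rei C P p K \<sqinter>\<^bsub>ex_fib C P (Dom C p)\<^esub> L) =
         K \<sqinter>\<^bsub>ex_fib C P (Cod C p)\<^esub> ex_image p L"
proof -
  have pH: "p \<in> Hom C (Dom C p) (Cod C p)"
    using projection_arr[OF p] by (simp add: Hom_iff)
  obtain h \<alpha> where y: "(h, \<alpha>) \<in> ex_pairs C P (Cod C p)" "K = ex_class (Cod C p) (h, \<alpha>)"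
    using K by (elim ex_carrierE) auto
  obtain g \<beta> where x: "(g, \<beta>) \<in> ex_pairs C P (Dom C p)" "L = ex_class (Dom C p) (g, \<beta>)"
    using L by (elim ex_carrierE) auto
  obtain h' p' where hpb: "is_pullback C p h h' p'"
    using projection_pullback_exists[of h p "Dom C p"] y(1) pH by (auto simp: ex_pairs_iff Hom_iff)
  have y': "(h', rei P p' \<alpha>) \<in> ex_pairs C P (Dom C p)"
    using pullback_in_ex_pairs[OF hpb pH y(1)] .
  obtain k k' where kpb: "is_pullback C g h' k k'"
    using projection_pullback_exists[of h' g "Dom C g"] y' x(1) by (auto simp: ex_pairs_iff Hom_iff)
  have pgpb: "is_pullback C (p \<cdot> g) h k (p' \<cdot> k')"
    using pullback_pasting[OF hpb kpb] .
  note legs = pullback_legs[OF hpb] pullback_legs[OF kpb]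
  let ?m = "rei P k \<beta> \<sqinter>\<^bsub>fib P (Dom C k)\<^esub> rei P k' (rei P p' \<alpha>)"
  have rei: "rei P (p' \<cdot> k') \<alpha> = rei P k' (rei P p' \<alpha>)"
    using legs y(1) by (intro rei_comp) (auto simp: ex_pairs_iff)
  have "ex_image p (L \<sqinter>\<^bsub>ex_fib C P (Dom C p)\<^esub> ex_rei C P p K) = ex_class (Cod C p) (p \<cdot> (g \<cdot> k), ?m)"
    using ex_rei_class[OF hpb pH y(1)] ex_meet_class[OF kpb x(1) y'] x(2) y(2)
      ex_image_class[OF p meet_in_ex_pairs[OF kpb x(1) y']] by simp
  also have "\<dots> = ex_image p L \<sqinter>\<^bsub>ex_fib C P (Cod C p)\<^esub> K"
    using ex_meet_class[OF pgpb cmp_in_ex_pairs[OF p x(1)] y(1)] ex_image_class[OF p x(1)] x(2) y(2)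
      rei legs x(1) by (simp add: ex_pairs_iff)
  finally show ?thesis
    by (simp only: meet_comm)
qed

theorem existential_doctrine_existential_completion:
  "existential_doctrine C (existential_completion C P)"
  by (intro existential_doctrine.intro existential_doctrine_axioms.intro
      primary_doctrine_existential_completion exI[of _ ex_image])
    (simp add: ex_image_left_adjoint ex_image_Beck_Chevalley ex_image_Frobenius)


section \<open>The existential completion is elementary\<close>

text \<open>The parametrised half of the definition of an elementary doctrine, isolated because it implies
  the other half and its parameters absorb the domains of the projections in the completion.\<close>

definition equality_predicate :: "'o \<Rightarrow> 'm \<Rightarrow> 'm \<Rightarrow> 'p \<Rightarrow> bool" where
  "equality_predicate A p1 p2 \<delta> \<longleftrightarrow> \<delta> \<in> carrier (fib P (Dom C p1)) \<and>
     (\<forall>X \<in> Obj C. \<forall>q1 q2 r1 r2 r3. is_product C X A q1 q2 \<longrightarrow> is_product3 C X A A r1 r2 r3 \<longrightarrow>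
        left_adjoint (fib P (Dom C q1)) (fib P (Dom C r1))
          (\<lambda>\<alpha>. rei P (pairing C q1 q2 r1 r2) \<alpha>
                 \<sqinter>\<^bsub>fib P (Dom C r1)\<^esub> rei P (pairing C p1 p2 r2 r3) \<delta>)
          (rei P (tripling C r1 r2 r3 q1 q2 q2)))"

text \<open>For \<open>X\<close> terminal, \<open>X \<times> A\<close> is \<open>A\<close> and \<open>X \<times> A \<times> A\<close> is \<open>A \<times> A\<close>. As product diagrams are arbitrary, the
  diagrams with legs \<open>t, id\<close> and \<open>s, p1, p2\<close> may be taken, for which the two adjunctions agree on
  the nose.\<close>

lemma equality_predicate_unparametrised:
  assumes A: "A \<in> Obj C" and p: "is_product C A A p1 p2" and \<delta>: "equality_predicate A p1 p2 \<delta>"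
  shows "left_adjoint (fib P A) (fib P (Dom C p1)) (\<lambda>\<alpha>. rei P p1 \<alpha> \<sqinter>\<^bsub>fib P (Dom C p1)\<^esub> \<delta>)
           (rei P (pairing C p1 p2 (Ide C A) (Ide C A)))"
proof -
  note legs = product_legs[OF p]
  obtain T where T: "is_terminal C T" and TC: "T \<in> Obj C"
    using terminal_exists by (auto simp: is_terminal_def)
  obtain t where t: "t \<in> Hom C A T"
    using T A unfolding is_terminal_def by blast
  define s where "s = t \<cdot> p1"
  have s: "s \<in> Hom C (Dom C p1) T"
    using t legs by (simp add: s_def Hom_iff)
  have q: "is_product C T A t (Ide C A)"
  proof (rule is_productI[where D = A])
    fix Z f g
    assume *: "f \<in> Hom C Z T" "g \<in> Hom C Z A"
    have "t \<cdot> g = f"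
      by (rule terminal_unique[OF T, where Z = Z]) (use * t in \<open>auto simp: Hom_iff\<close>)
    then show "\<exists>h \<in> Hom C Z A. t \<cdot> h = f \<and> Ide C A \<cdot> h = g"
      using * by (intro bexI[of _ g]) (auto simp: Hom_iff)
  qed (use A t in \<open>auto simp: Hom_iff\<close>)
  have r: "is_product3 C T A A s p1 p2"
  proof (rule is_product3I[where E = "Dom C p1"])
    fix Z f g k
    assume *: "f \<in> Hom C Z T" "g \<in> Hom C Z A" "k \<in> Hom C Z A"
    obtain h where h: "h \<in> Hom C Z (Dom C p1)" "p1 \<cdot> h = g" "p2 \<cdot> h = k"
      using product_arrow[OF p *(2,3)] .
    have "s \<cdot> h = f"
      by (rule terminal_unique[OF T, where Z = Z]) (use * s h in \<open>auto simp: Hom_iff\<close>)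
    with h show "\<exists>h \<in> Hom C Z (Dom C p1). s \<cdot> h = f \<and> p1 \<cdot> h = g \<and> p2 \<cdot> h = k"
      by blast
  next
    fix Z h k
    assume "h \<in> Hom C Z (Dom C p1)" "k \<in> Hom C Z (Dom C p1)" "p1 \<cdot> h = p1 \<cdot> k" "p2 \<cdot> h = p2 \<cdot> k"
    then show "h = k"
      by (rule product_arrow_eqI[OF p])
  qed (use s legs in \<open>auto simp: Hom_iff\<close>)
  have dom: "Dom C t = A" "Dom C s = Dom C p1"
    using t s by (auto simp: Hom_iff)
  obtain d where d: "d \<in> Hom C A (Dom C p1)" "p1 \<cdot> d = Ide C A" "p2 \<cdot> d = Ide C A"
    using product_arrow[OF p ide_hom[OF A] ide_hom[OF A]] .
  have "s \<cdot> d = t"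
    by (rule terminal_unique[OF T, where Z = A]) (use s t d in \<open>auto simp: Hom_iff\<close>)
  then have "tripling C s p1 p2 t (Ide C A) (Ide C A) = d"
    using tripling_eqI[OF r] d dom by metis
  moreover have "pairing C p1 p2 (Ide C A) (Ide C A) = d"
    using pairing_eqI[OF p d] .
  moreover have "pairing C t (Ide C A) s p1 = p1"
    by (rule pairing_eqI[OF q, where Z = "Dom C p1"]) (use legs dom in \<open>auto simp: Hom_iff s_def\<close>)
  moreover have "pairing C p1 p2 p1 p2 = Ide C (Dom C p1)"
    by (rule pairing_eqI[OF p, where Z = "Dom C p1"]) (use legs in \<open>auto simp: Hom_iff\<close>)
  moreover have "\<delta> \<in> carrier (fib P (Dom C p1))"
    using \<delta> by (simp add: equality_predicate_def)
  moreover have "left_adjoint (fib P (Dom C t)) (fib P (Dom C s))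
      (\<lambda>\<alpha>. rei P (pairing C t (Ide C A) s p1) \<alpha>
         \<sqinter>\<^bsub>fib P (Dom C s)\<^esub> rei P (pairing C p1 p2 p1 p2) \<delta>)
      (rei P (tripling C s p1 p2 t (Ide C A) (Ide C A)))"
    using \<delta> TC q r unfolding equality_predicate_def by blast
  ultimately show ?thesis
    using legs by (simp add: dom rei_ide)
qed

lemma elementary_doctrineI:
  assumes "\<And>A p1 p2. \<lbrakk>A \<in> Obj C; is_product C A A p1 p2\<rbrakk> \<Longrightarrow> \<exists>\<delta>. equality_predicate A p1 p2 \<delta>"
  shows "elementary_doctrine C P"
proof (intro elementary_doctrine.intro elementary_doctrine_axioms.intro primary_doctrine_axioms)
  fix A p1 p2
  assume A: "A \<in> Obj C" "is_product C A A p1 p2"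
  obtain \<delta> where \<delta>: "equality_predicate A p1 p2 \<delta>"
    using assms[OF A] by blast
  show "\<exists>\<delta> \<in> carrier (fib P (Dom C p1)).
      left_adjoint (fib P A) (fib P (Dom C p1))
        (\<lambda>\<alpha>. rei P p1 \<alpha> \<sqinter>\<^bsub>fib P (Dom C p1)\<^esub> \<delta>)
        (rei P (pairing C p1 p2 (Ide C A) (Ide C A))) \<and>
      (\<forall>X \<in> Obj C. \<forall>q1 q2 r1 r2 r3.
         is_product C X A q1 q2 \<longrightarrow> is_product3 C X A A r1 r2 r3 \<longrightarrow>
         left_adjoint (fib P (Dom C q1)) (fib P (Dom C r1))
           (\<lambda>\<alpha>. rei P (pairing C q1 q2 r1 r2) \<alpha>
                  \<sqinter>\<^bsub>fib P (Dom C r1)\<^esub> rei P (pairing C p1 p2 r2 r3) \<delta>)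
           (rei P (tripling C r1 r2 r3 q1 q2 q2)))"
    using equality_predicate_unparametrised[OF A \<delta>] \<delta> unfolding equality_predicate_def by blast
qed

end

context elementary_doctrine
begin

lemma equality_predicate_exists:
  assumes "A \<in> Obj C" "is_product C A A p1 p2"
  shows "\<exists>\<delta>. equality_predicate A p1 p2 \<delta>"
  using elementary[OF assms] unfolding equality_predicate_def by blast

end

context primary_doctrine
begin

text \<open>If \<open>g\<close> is a projection from \<open>X \<times> A \<times> B\<close> to \<open>X \<times> A\<close>, its domain is the product of \<open>X \<times> B\<close> and \<open>A\<close>, and
  the domain of its pullback along \<open>d\<close> is the product of \<open>X \<times> B\<close> and two copies of \<open>A\<close>. The section
  \<open>e'\<close> of \<open>d'\<close> over \<open>e\<close> is the diagonal of \<open>A\<close> with parameters in \<open>X \<times> B\<close>, so the adjunction is an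
  instance of the hypothesis.\<close>

lemma equality_predicate_over_projection:
  assumes \<delta>: "equality_predicate A p1 p2 \<delta>" and p: "is_product C A A p1 p2"
    and q: "is_product C X A q1 q2" and r: "is_product3 C X A A r1 r2 r3"
    and g: "is_projection C g" "Cod C g = Dom C q1"
    and pb: "is_pullback C (pairing C q1 q2 r1 r2) g g' d'"
  obtains e' where "e' \<in> Hom C (Dom C g) (Dom C g')" "d' \<cdot> e' = Ide C (Dom C g)"
    "g' \<cdot> e' = tripling C r1 r2 r3 q1 q2 q2 \<cdot> g"
    "left_adjoint (fib P (Dom C g)) (fib P (Dom C g'))
       (\<lambda>\<beta>. rei P d' \<beta> \<sqinter>\<^bsub>fib P (Dom C g')\<^esub> rei P g' (rei P (pairing C p1 p2 r2 r3) \<delta>))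
       (rei P e')"
proof -
  note legs = product_legs[OF p] product_legs[OF q] product3_legs[OF r] projection_arr[OF g(1)] g(2)
  obtain d where d: "d \<in> Hom C (Dom C r1) (Dom C q1)" "q1 \<cdot> d = r1" "q2 \<cdot> d = r2"
    using product_arrow[OF q, of r1 "Dom C r1" r2] legs by (auto simp: Hom_iff)
  have d_eq: "pairing C q1 q2 r1 r2 = d"
    by (rule pairing_eqI[OF q d])
  obtain e where e: "e \<in> Hom C (Dom C q1) (Dom C r1)" "r1 \<cdot> e = q1" "r2 \<cdot> e = q2" "r3 \<cdot> e = q2"
    using product3_arrow[OF r, of q1 "Dom C q1" q2 q2] legs by (auto simp: Hom_iff)
  have e_eq: "tripling C r1 r2 r3 q1 q2 q2 = e"
    by (rule tripling_eqI[OF r e])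
  obtain c where c: "c \<in> Hom C (Dom C r1) (Dom C p1)" "p1 \<cdot> c = r2" "p2 \<cdot> c = r3"
    using product_arrow[OF p, of r2 "Dom C r1" r3] legs by (auto simp: Hom_iff)
  have c_eq: "pairing C p1 p2 r2 r3 = c"
    by (rule pairing_eqI[OF p c])
  note pb = pb[unfolded d_eq]
  note pb_legs = pullback_legs[OF pb]
  note arr = legs pb_legs d(1)[unfolded Hom_iff] e(1)[unfolded Hom_iff] c(1)[unfolded Hom_iff]
  have de: "d \<cdot> e = Ide C (Dom C q1)"
    by (rule product_arrow_eqI[OF q, where Z = "Dom C q1"])
      (use arr e(2,3) cmp_eq_extend[OF d(2), of e] cmp_eq_extend[OF d(3), of e] in \<open>auto simp: Hom_iff\<close>)
  have eg: "e \<cdot> g \<in> Hom C (Dom C g) (Dom C d)" "d \<cdot> (e \<cdot> g) = g \<cdot> Ide C (Dom C g)"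
    using arr cmp_eq_extend[OF de, of g] by (auto simp: Hom_iff)
  obtain e' where e': "e' \<in> Hom C (Dom C g) (Dom C g')" "g' \<cdot> e' = e \<cdot> g" "d' \<cdot> e' = Ide C (Dom C g)"
    using pullback_arrow[OF pb eg(1) _ eg(2)] ide_hom[of "Dom C g"] arr by auto
  obtain B s where s: "is_product C (Dom C q1) B g s"
    using g by (auto simp: is_projection_def)
  note s_legs = product_legs[OF s]
  obtain x1 x2 where x: "is_product C X B x1 x2"
    using product_exists[of X B] legs s_legs by (metis dom_cod_obj(2))
  note x_legs = product_legs[OF x]
  obtain u where u: "u \<in> Hom C (Dom C g) (Dom C x1)" "x1 \<cdot> u = q1 \<cdot> g" "x2 \<cdot> u = s"
    using product_arrow[OF x, of "q1 \<cdot> g" "Dom C g" s] arr s_legs by (auto simp: Hom_iff)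
  note arr = arr s_legs x_legs u(1)[unfolded Hom_iff] e'(1)[unfolded Hom_iff]
  \<comment> \<open>Here \<open>x1, x2\<close> are the projections of \<open>X \<times> B\<close>, and \<open>u\<close> is the projection of
      \<open>X \<times> A \<times> B\<close> onto it.\<close>
  have x1u: "x1 \<cdot> (u \<cdot> h) = q1 \<cdot> (g \<cdot> h)" and x2u: "x2 \<cdot> (u \<cdot> h) = s \<cdot> h"
    if "h \<in> Hom C Z (Dom C g)" for h Z
    using that arr cmp_eq_extend[OF u(2), of h] cmp_eq_extend[OF u(3), of h]
    by (auto simp: Hom_iff)
  have gd': "g \<cdot> (d' \<cdot> h) = d \<cdot> (g' \<cdot> h)" if "h \<in> Hom C Z (Dom C g')" for h Z
    using that arr cmp_eq_extend[OF pb_legs(9), of h] by (auto simp: Hom_iff)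
  have q1d: "q1 \<cdot> (d \<cdot> k) = r1 \<cdot> k" and q2d: "q2 \<cdot> (d \<cdot> k) = r2 \<cdot> k"
    if "k \<in> Hom C Z (Dom C r1)" for k Z
    using that arr cmp_eq_extend[OF d(2), of k] cmp_eq_extend[OF d(3), of k] by (auto simp: Hom_iff)
  have Q: "is_product C (Dom C x1) A u (q2 \<cdot> g)"
  proof (rule is_productI[where D = "Dom C g"])
    fix Z a b
    assume a: "a \<in> Hom C Z (Dom C x1)" and b: "b \<in> Hom C Z A"
    have xa: "x1 \<cdot> a \<in> Hom C Z X" "x2 \<cdot> a \<in> Hom C Z B"
      using a arr by (auto simp: Hom_iff)
    obtain m where m: "m \<in> Hom C Z (Dom C q1)" "q1 \<cdot> m = x1 \<cdot> a" "q2 \<cdot> m = b"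
      using product_arrow[OF q xa(1) b] .
    obtain l where l: "l \<in> Hom C Z (Dom C g)" "g \<cdot> l = m" "s \<cdot> l = x2 \<cdot> a"
      using product_arrow[OF s m(1) xa(2)] .
    have "u \<cdot> l = a"
      by (rule product_arrow_eqI[OF x, where Z = Z])
        (use l a m x1u[OF l(1)] x2u[OF l(1)] arr in \<open>auto simp: Hom_iff\<close>)
    then show "\<exists>h \<in> Hom C Z (Dom C g). u \<cdot> h = a \<and> (q2 \<cdot> g) \<cdot> h = b"
      using l m(3) arr by (intro bexI[of _ l]) (auto simp: Hom_iff)
  next
    fix Z h k
    assume h: "h \<in> Hom C Z (Dom C g)" and k: "k \<in> Hom C Z (Dom C g)"
      and eq: "u \<cdot> h = u \<cdot> k" "(q2 \<cdot> g) \<cdot> h = (q2 \<cdot> g) \<cdot> k"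
    have gh: "g \<cdot> h = g \<cdot> k"
      by (rule product_arrow_eqI[OF q, where Z = Z])
        (use h k eq x1u[OF h] x1u[OF k] arr in \<open>auto simp: Hom_iff\<close>)
    have sh: "s \<cdot> h = s \<cdot> k"
      using eq(1) x2u[OF h] x2u[OF k] by simp
    show "h = k"
      by (rule product_arrow_eqI[OF s h k gh sh])
  qed (use arr in \<open>auto simp: Hom_iff\<close>)
  have R: "is_product3 C (Dom C x1) A A (u \<cdot> d') (r2 \<cdot> g') (r3 \<cdot> g')"
  proof (rule is_product3I[where E = "Dom C g'"])
    fix Z a b b'
    assume a: "a \<in> Hom C Z (Dom C x1)" and b: "b \<in> Hom C Z A" and b': "b' \<in> Hom C Z A"
    have xa: "x1 \<cdot> a \<in> Hom C Z X"
      using a arr by (auto simp: Hom_iff)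
    obtain k where k: "k \<in> Hom C Z (Dom C r1)" "r1 \<cdot> k = x1 \<cdot> a" "r2 \<cdot> k = b" "r3 \<cdot> k = b'"
      using product3_arrow[OF r xa b b'] .
    obtain l where l: "l \<in> Hom C Z (Dom C g)" "u \<cdot> l = a" "(q2 \<cdot> g) \<cdot> l = b"
      using product_arrow[OF Q a b] arr by auto
    have dk: "d \<cdot> k = g \<cdot> l"
      by (rule product_arrow_eqI[OF q, where Z = Z])
        (use k l x1u[OF l(1)] q1d[OF k(1)] q2d[OF k(1)] arr in \<open>auto simp: Hom_iff\<close>)
    have kd: "k \<in> Hom C Z (Dom C d)"
      using k(1) arr by simp
    obtain h where h: "h \<in> Hom C Z (Dom C g')" "g' \<cdot> h = k" "d' \<cdot> h = l"
      using pullback_arrow[OF pb kd l(1) dk] .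
    show "\<exists>h \<in> Hom C Z (Dom C g').
        (u \<cdot> d') \<cdot> h = a \<and> (r2 \<cdot> g') \<cdot> h = b \<and> (r3 \<cdot> g') \<cdot> h = b'"
      using h k l arr by (intro bexI[of _ h]) (auto simp: Hom_iff)
  next
    fix Z h k
    assume h: "h \<in> Hom C Z (Dom C g')" and k: "k \<in> Hom C Z (Dom C g')"
      and eq: "(u \<cdot> d') \<cdot> h = (u \<cdot> d') \<cdot> k" "(r2 \<cdot> g') \<cdot> h = (r2 \<cdot> g') \<cdot> k"
        "(r3 \<cdot> g') \<cdot> h = (r3 \<cdot> g') \<cdot> k"
    have t: "d' \<cdot> h \<in> Hom C Z (Dom C g)" "d' \<cdot> k \<in> Hom C Z (Dom C g)"
      "g' \<cdot> h \<in> Hom C Z (Dom C r1)" "g' \<cdot> k \<in> Hom C Z (Dom C r1)"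
      using h k arr by (auto simp: Hom_iff)
    have dh: "d' \<cdot> h = d' \<cdot> k"
      by (rule product_arrow_eqI[OF Q, where Z = Z])
        (use t h k eq gd'[OF h] gd'[OF k] q2d[OF t(3)] q2d[OF t(4)] arr in \<open>auto simp: Hom_iff\<close>)
    have r1h: "r1 \<cdot> (g' \<cdot> h) = r1 \<cdot> (g' \<cdot> k)"
      using dh gd'[OF h] gd'[OF k] q1d[OF t(3)] q1d[OF t(4)] by metis
    have gh: "g' \<cdot> h = g' \<cdot> k"
      by (rule product3_arrow_eqI[OF r t(3,4) r1h]) (use h k eq arr in \<open>auto simp: Hom_iff\<close>)
    show "h = k"
      by (rule pullback_arrow_eqI[OF pb h k gh dh])
  qed (use arr in \<open>auto simp: Hom_iff\<close>)
  have "pairing C u (q2 \<cdot> g) (u \<cdot> d') (r2 \<cdot> g') = d'"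
    by (rule pairing_eqI[OF Q, where Z = "Dom C g'"])
      (use arr q2d[of g' "Dom C g'"] in \<open>auto simp: Hom_iff\<close>)
  moreover have "pairing C p1 p2 (r2 \<cdot> g') (r3 \<cdot> g') = c \<cdot> g'"
    by (rule pairing_eqI[OF p, where Z = "Dom C g'"])
      (use arr cmp_eq_extend[OF c(2), of g'] cmp_eq_extend[OF c(3), of g'] in \<open>auto simp: Hom_iff\<close>)
  moreover have "tripling C (u \<cdot> d') (r2 \<cdot> g') (r3 \<cdot> g') u (q2 \<cdot> g) (q2 \<cdot> g) = e'"
    by (rule tripling_eqI[OF R, where Z = "Dom C g"])
      (use arr e'(2,3) cmp_eq_extend[OF e(3), of g] cmp_eq_extend[OF e(4), of g] in \<open>auto simp: Hom_iff\<close>)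
  moreover have "Dom C u = Dom C g" "Dom C (u \<cdot> d') = Dom C g'"
    using arr by auto
  moreover have "rei P (c \<cdot> g') \<delta> = rei P g' (rei P c \<delta>)"
    using \<delta> arr by (intro rei_comp) (auto simp: equality_predicate_def)
  moreover have "left_adjoint (fib P (Dom C u)) (fib P (Dom C (u \<cdot> d')))
      (\<lambda>\<alpha>. rei P (pairing C u (q2 \<cdot> g) (u \<cdot> d') (r2 \<cdot> g')) \<alpha> \<sqinter>\<^bsub>fib P (Dom C (u \<cdot> d'))\<^esub>
         rei P (pairing C p1 p2 (r2 \<cdot> g') (r3 \<cdot> g')) \<delta>)
      (rei P (tripling C (u \<cdot> d') (r2 \<cdot> g') (r3 \<cdot> g') u (q2 \<cdot> g) (q2 \<cdot> g)))"
    using \<delta> Q R dom_obj[of x1] arr unfolding equality_predicate_def by blast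
  ultimately show ?thesis
    using that[OF e'(1,3)] e'(2) by (simp add: c_eq e_eq)
qed

text \<open>Since the identity is the neutral projection, the left adjoint sends \<open>(g, \<beta>)\<close> to a pair \<open>(g', m)\<close>
  with \<open>g'\<close> the pullback of \<open>g\<close> along \<open>d\<close>. The adjunction of \<open>P\<close> along \<open>e'\<close> translates the condition on
  predicates for a witness \<open>w\<close> into that for \<open>w \<cdot> e'\<close>, and every witness of the other side has this
  form by lifting against \<open>e'\<close>.\<close>

lemma equality_predicate_existential_completion:
  assumes \<delta>: "equality_predicate A p1 p2 \<delta>" and p: "is_product C A A p1 p2"
  shows "primary_doctrine.equality_predicate C (existential_completion C P) A p1 p2
           (ex_class (Dom C p1) (Ide C (Dom C p1), \<delta>))"
  unfolding primary_doctrine.equality_predicate_def[OF primary_doctrine_existential_completion]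
    existential_completion_simps
proof (intro conjI ballI allI impI)
  note p_legs = product_legs[OF p]
  have \<delta>c: "\<delta> \<in> carrier (fib P (Dom C p1))"
    using \<delta> by (simp add: equality_predicate_def)
  have \<delta>p: "(Ide C (Dom C p1), \<delta>) \<in> ex_pairs C P (Dom C p1)"
    using p_legs \<delta>c by (simp add: ex_pairs_iff projection_ide)
  then show "ex_class (Dom C p1) (Ide C (Dom C p1), \<delta>) \<in> carrier (ex_fib C P (Dom C p1))"
    by simp
  fix X q1 q2 r1 r2 r3
  assume q: "is_product C X A q1 q2" and r: "is_product3 C X A A r1 r2 r3"
  note legs = p_legs product_legs[OF q] product3_legs[OF r]
  define d where "d = pairing C q1 q2 r1 r2"
  define c where "c = pairing C p1 p2 r2 r3"
  define e where "e = tripling C r1 r2 r3 q1 q2 q2"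
  have d: "d \<in> Hom C (Dom C r1) (Dom C q1)"
    using product_arrow[OF q, of r1 "Dom C r1" r2] pairing_eqI[OF q, of _ "Dom C r1"] legs
    unfolding d_def by (metis Hom_iff)
  have c: "c \<in> Hom C (Dom C r1) (Dom C p1)"
    using product_arrow[OF p, of r2 "Dom C r1" r3] pairing_eqI[OF p, of _ "Dom C r1"] legs
    unfolding c_def by (metis Hom_iff)
  have e: "e \<in> Hom C (Dom C q1) (Dom C r1)"
    using product3_arrow[OF r, of q1 "Dom C q1" q2 q2] tripling_eqI[OF r, of _ "Dom C q1"] legs
    unfolding e_def by (metis Hom_iff)
  note arr = legs d[unfolded Hom_iff] c[unfolded Hom_iff] e[unfolded Hom_iff]
  let ?\<delta> = "ex_rei C P c (ex_class (Dom C p1) (Ide C (Dom C p1), \<delta>))"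
  let ?l = "\<lambda>K. ex_rei C P d K \<sqinter>\<^bsub>ex_fib C P (Dom C r1)\<^esub> ?\<delta>"
  \<comment> \<open>Identities pull back to identities, so \<open>c\<close> acts on \<open>(id, \<delta>)\<close> through \<open>P\<close> alone.\<close>
  have idpb: "is_pullback C c (Ide C (Dom C p1)) (Ide C (Dom C r1)) c"
    using is_pullback_sym[OF pullback_along_ide[of c]] arr by simp
  have \<delta>': "?\<delta> = ex_class (Dom C r1) (Ide C (Dom C r1), rei P c \<delta>)"
    "(Ide C (Dom C r1), rei P c \<delta>) \<in> ex_pairs C P (Dom C r1)"
    using ex_rei_class[OF idpb c \<delta>p] pullback_in_ex_pairs[OF idpb c \<delta>p] .
  show "left_adjoint (ex_fib C P (Dom C q1)) (ex_fib C P (Dom C r1)) ?l (ex_rei C P e)"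
  proof (rule left_adjointI[OF ex_fib_partial_order ex_fib_partial_order])
    show "ex_rei C P e L \<in> carrier (ex_fib C P (Dom C q1))"
      if "L \<in> carrier (ex_fib C P (Dom C r1))" for L
      using ex_rei_closed[OF e that] .
    fix K
    assume "K \<in> carrier (ex_fib C P (Dom C q1))"
    then obtain g \<beta> where x: "(g, \<beta>) \<in> ex_pairs C P (Dom C q1)" "K = ex_class (Dom C q1) (g, \<beta>)"
      by (elim ex_carrierE) auto
    have g: "is_projection C g" "Cod C g = Dom C q1" "g \<in> Arr C" "\<beta> \<in> carrier (fib P (Dom C g))"
      using x(1) by (auto simp: ex_pairs_iff)
    obtain g' d' where pb: "is_pullback C d g g' d'"
      using projection_pullback_exists[of g d "Dom C r1"] g d by auto
    note pb_legs = pullback_legs[OF pb]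
    have x': "(g', rei P d' \<beta>) \<in> ex_pairs C P (Dom C r1)"
      using pullback_in_ex_pairs[OF pb d x(1)] .
    let ?m = "rei P d' \<beta> \<sqinter>\<^bsub>fib P (Dom C g')\<^esub> rei P g' (rei P c \<delta>)"
    have g'pb: "is_pullback C g' (Ide C (Dom C r1)) (Ide C (Dom C g')) g'"
      using is_pullback_sym[OF pullback_along_ide[of g']] pb_legs arr by simp
    have m: "?l K = ex_class (Dom C r1) (g', ?m)" and m_pair: "(g', ?m) \<in> ex_pairs C P (Dom C r1)"
      using ex_meet_class[OF g'pb x' \<delta>'(2)] meet_in_ex_pairs[OF g'pb x' \<delta>'(2)] \<delta>'(1)
        ex_rei_class[OF pb d x(1)] x(2) x' pb_legs by (simp_all add: rei_ide ex_pairs_iff)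
    show "?l K \<in> carrier (ex_fib C P (Dom C r1))"
      using m m_pair by simp
    obtain e' where e': "e' \<in> Hom C (Dom C g) (Dom C g')" "d' \<cdot> e' = Ide C (Dom C g)"
        "g' \<cdot> e' = e \<cdot> g"
      and adj: "left_adjoint (fib P (Dom C g)) (fib P (Dom C g'))
       (\<lambda>\<beta>. rei P d' \<beta> \<sqinter>\<^bsub>fib P (Dom C g')\<^esub> rei P g' (rei P c \<delta>)) (rei P e')"
      using equality_predicate_over_projection[OF \<delta> p q r g(1,2) pb[unfolded d_def]]
      unfolding c_def e_def by blast
    fix L
    assume "L \<in> carrier (ex_fib C P (Dom C r1))"
    then obtain f \<gamma> where y: "(f, \<gamma>) \<in> ex_pairs C P (Dom C r1)" "L = ex_class (Dom C r1) (f, \<gamma>)"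
      by (elim ex_carrierE) auto
    have f: "is_projection C f" "f \<in> Hom C (Dom C f) (Dom C r1)" "\<gamma> \<in> carrier (fib P (Dom C f))"
      using y(1) by (auto simp: ex_pairs_iff Hom_iff)
    have transpose: "?m \<sqsubseteq>\<^bsub>fib P (Dom C g')\<^esub> rei P w \<gamma> \<longleftrightarrow> \<beta> \<sqsubseteq>\<^bsub>fib P (Dom C g)\<^esub> rei P (w \<cdot> e') \<gamma>"
      if "w \<in> Hom C (Dom C g') (Dom C f)" for w
      using that left_adjointD[OF adj g(4), of "rei P w \<gamma>"] e'(1) f(3)
      by (simp add: Hom_iff rei_comp)
    have "ex_le C P (g', ?m) (f, \<gamma>) \<longleftrightarrow> ex_over e (g, \<beta>) (f, \<gamma>)"
    proof
      assume "ex_le C P (g', ?m) (f, \<gamma>)"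
      then obtain w where w: "w \<in> Hom C (Dom C g') (Dom C f)" "f \<cdot> w = g'"
        "?m \<sqsubseteq>\<^bsub>fib P (Dom C g')\<^esub> rei P w \<gamma>"
        by (auto simp: ex_le_def)
      have "f \<cdot> (w \<cdot> e') = e \<cdot> g"
        using cmp_eq_extend[OF w(2), of e'] w(1) f(2) e'(1,3) by (simp add: Hom_iff)
      then show "ex_over e (g, \<beta>) (f, \<gamma>)"
        using w transpose[OF w(1)] e'(1) unfolding ex_over_iff
        by (intro bexI[of _ "w \<cdot> e'"]) (auto simp: Hom_iff)
    next
      assume "ex_over e (g, \<beta>) (f, \<gamma>)"
      then obtain v where v: "v \<in> Hom C (Dom C g) (Dom C f)" "f \<cdot> v = e \<cdot> g"
        "\<beta> \<sqsubseteq>\<^bsub>fib P (Dom C g)\<^esub> rei P v \<gamma>"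
        by (auto simp: ex_over_iff)
      have t: "d' \<in> Hom C (Dom C g') (Dom C g)" "g' \<in> Hom C (Dom C g') (Dom C r1)"
        using pb_legs arr by (auto simp: Hom_iff)
      obtain w where w: "w \<in> Hom C (Dom C g') (Dom C f)" "f \<cdot> w = g'" "w \<cdot> e' = v"
        using projection_lift[OF f(1,2) e'(1) t(1) e'(2) t(2) v(1)] v(2) e'(3) by metis
      then show "ex_le C P (g', ?m) (f, \<gamma>)"
        using v(3) transpose[OF w(1)] by (auto simp: ex_le_def)
    qed
    then show "?l K \<sqsubseteq>\<^bsub>ex_fib C P (Dom C r1)\<^esub> L \<longleftrightarrow> K \<sqsubseteq>\<^bsub>ex_fib C P (Dom C q1)\<^esub> ex_rei C P e L"
      unfolding m unfolding x(2) y(2) ex_fib_le_iff[OF m_pair y(1)] ex_le_rei_iff[OF e x(1) y(1)] .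
  qed
qed

end

theorem (in elementary_doctrine) elementary_doctrine_existential_completion:
  "elementary_doctrine C (existential_completion C P)"
  using primary_doctrine.elementary_doctrineI[OF primary_doctrine_existential_completion]
    equality_predicate_existential_completion equality_predicate_exists by meson

theorem proposition6p1:
  fixes C :: "('o, 'm) cat" and P :: "('o, 'm, 'p) doctrine"
  assumes "elementary_doctrine C P"
  shows "elementary_doctrine C (existential_completion C P) \<and>
         existential_doctrine C (existential_completion C P)"
proof -
  interpret elementary_doctrine C P
    by fact
  show ?thesis
    using elementary_doctrine_existential_completion existential_doctrine_existential_completion ..
qed

end
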